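(* Let $m,n$ be positive integers and $G\cong C_m\ltimes_{\varphi} C_{mn}$. Then $$\mathsf s_{mn\mathbb N}(G)=m+2mn-2.$$ If moreover $\mathsf e(G)=mn$, then $$\eta(G)\le 2m+mn-2\quad\text{and}\quad \mathsf s(G)\le 2m+2mn-3.$$
   Context: Groups are written multiplicatively with identity $1$. A sequence over $G$ is a finite unordered list of elements of $G$ with repetition allowed; its length $|S|$ is the number of terms. A sequence $S=a_1\cdot\ldots\cdot a_k$ is product-one if $1=a_{\tau(1)}\cdots a_{\tau(k)}$ for some permutation $\tau$ of $\{1,\dots,k\}$. For $L\subset\mathbb N$, $\mathsf s_L(G)$ is the smallest $l\in\mathbb N_0\cup\{\infty\}$ such that every sequence $S$ over $G$ with $|S|\ge l$ has a product-one subsequence $T$ with $|T|\in L$. Let $\mathsf e(G)=\max\{\mathrm{ord}(g):g\in G\}$. Then $\mathsf s(G)=\mathsf s_{\{\mathsf e(G)\}}(G)$, $\eta(G)=\mathsf s_{[1,\mathsf e(G)]}(G)$, and $\mathsf s_{d\mathbb N}(G)$ uses $L=\{d,2d,3d,\dots\}$. For positive integers $a,b$, $C_a\ltimes_{\varphi} C_b$ denotes a group generated by $x,y$ with $\mathrm{ord}(x)=b$, $\mathrm{ord}(y)=a$, $\langle x\rangle\cap\langle y\rangle=\{1\}$ and $yxy^{-1}=x^s$ for some integer $s$ with $1\le s\le b-1$ (a semidirect product of the normal cyclic subgroup $\langle x\rangle$ by $\langle y\rangle$ via any homomorphism $\varphi:C_a\to\mathrm{Aut}(C_b)$). *)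

theory Defs
  imports
    "HOL-Algebra.Generated_Groups"
    "HOL-Algebra.Multiplicative_Group"
    "HOL-Library.Multiset"
    "HOL-Library.Extended_Nat"
begin

text \<open>Sequences over \<open>G\<close> are finite multisets with support in the carrier, and subsequences are
  submultisets.\<close>

definition seq_over :: "('a, 'b) monoid_scheme \<Rightarrow> 'a multiset \<Rightarrow> bool" where
  "seq_over G S \<longleftrightarrow> set_mset S \<subseteq> carrier G"

text \<open>The lists \<open>xs\<close> with \<open>mset xs = S\<close> are exactly the orderings of the terms of \<open>S\<close>.\<close>

definition product_one :: "('a, 'b) monoid_scheme \<Rightarrow> 'a multiset \<Rightarrow> bool" where
  "product_one G S \<longleftrightarrow> (\<exists>xs. mset xs = S \<and> foldr (\<otimes>\<^bsub>G\<^esub>) xs \<one>\<^bsub>G\<^esub> = \<one>\<^bsub>G\<^esub>)"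

text \<open>The value \<open>\<infinity>\<close> always satisfies the condition below vacuously, since every multiset has finite
  size; it is attained exactly if no natural number satisfies it.\<close>

definition s_L :: "nat set \<Rightarrow> ('a, 'b) monoid_scheme \<Rightarrow> enat" where
  "s_L L G = (LEAST l::enat. \<forall>S. seq_over G S \<and> l \<le> enat (size S) \<longrightarrow>
     (\<exists>T. T \<subseteq># S \<and> product_one G T \<and> size T \<in> L))"

text \<open>The maximum is meaningful when the set of element orders is finite; in the library, elements
  of infinite order have \<open>ord\<close> equal to \<open>0\<close>.\<close>

definition max_ord :: "('a, 'b) monoid_scheme \<Rightarrow> nat" where
  "max_ord G = Max {group.ord G g | g. g \<in> carrier G}"

definition s_inv :: "('a, 'b) monoid_scheme \<Rightarrow> enat" where
  "s_inv G = s_L {max_ord G} G"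

definition eta_inv :: "('a, 'b) monoid_scheme \<Rightarrow> enat" where
  "eta_inv G = s_L {1..max_ord G} G"

definition s_mult :: "nat \<Rightarrow> ('a, 'b) monoid_scheme \<Rightarrow> enat" where
  "s_mult d G = s_L {k * d | k. 1 \<le> k} G"

text \<open>\<open>is_cyclic_semidirect a b G\<close>: the group \<open>G\<close> is (isomorphic to) a semidirect product of a normal
  cyclic group of order \<open>b\<close> by a cyclic group of order \<open>a\<close>. For \<open>b \<ge> 2\<close> the exponent ranges over
  \<open>1 \<le> s \<le> b - 1\<close>. For \<open>b = 1\<close> that range is empty, and \<open>max\<close> lets \<open>s = 1\<close> stand for the only
  (trivial) action. The assumptions \<open>a, b > 0\<close> rule out infinite order, for which \<open>ord\<close> is \<open>0\<close>.\<close>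

definition is_cyclic_semidirect :: "nat \<Rightarrow> nat \<Rightarrow> ('a, 'b) monoid_scheme \<Rightarrow> bool" where
  "is_cyclic_semidirect a b G \<longleftrightarrow> 0 < a \<and> 0 < b \<and> group G \<and>
     (\<exists>x\<in>carrier G. \<exists>y\<in>carrier G.
        generate G {x, y} = carrier G \<and>
        group.ord G x = b \<and> group.ord G y = a \<and>
        generate G {x} \<inter> generate G {y} = {\<one>\<^bsub>G\<^esub>} \<and>
        (\<exists>s::nat. 1 \<le> s \<and> s \<le> max 1 (b - 1) \<and>
           y \<otimes>\<^bsub>G\<^esub> x \<otimes>\<^bsub>G\<^esub> inv\<^bsub>G\<^esub> y = x [^]\<^bsub>G\<^esub> s))"

end

theory Submission
  imports Defs "HOL-Number_Theory.Residues"
begin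

text \<open>Let \<open>p\<close> be the smallest prime divisor of \<open>m\<close>. Then \<open>s\<close> is \<open>1\<close> modulo \<open>p\<close>, hence the elements
  \<open>x ^ i * y ^ j\<close> with \<open>p\<close> dividing \<open>i\<close> and \<open>j\<close> form a normal subgroup \<open>H\<close> of the same shape, with
  \<open>m / p\<close> in place of \<open>m\<close>, and the quotient by \<open>H\<close> is \<open>C\<^sub>p \<times> C\<^sub>p\<close>. One extracts from a sequence over
  \<open>G\<close> as many blocks with product in \<open>H\<close> as possible, using Reiher's theorem \<open>s(C\<^sub>p \<times> C\<^sub>p) = 4 p - 3\<close>,
  and applies induction to the sequence of the block products; since the quotient is abelian, the
  order inside a block does not matter. The case \<open>m = 1\<close> is that of a cyclic group. The lower bound
  is attained by \<open>m n - 1\<close> copies of the identity, \<open>m n - 1\<close> copies of \<open>x\<close> and \<open>m - 1\<close> copies of \<open>y\<close>.\<close>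

section \<open>Alternating sums over subsets\<close>

text \<open>The forms \<open>m + 2 m n\<close>, \<open>2 m + m n\<close> and
  \<open>2 m + 2 m n\<close> are multiplied by \<open>p\<close> when \<open>m'\<close> becomes
  \<open>m = p m'\<close>; the subtracted constants come from \<open>C_p x C_p\<close>. By the bound
  \<open>4 p - 3\<close>, a length \<open>l\<close> with \<open>l + 3 >= p (r + 3)\<close> yields
  \<open>r\<close> blocks of length \<open>p\<close>; by the bound \<open>3 p - 2\<close> for short
  zero-sum subsequences, \<open>l + 2 >= p (r + 2)\<close> yields \<open>r\<close> nonempty blocks
  of length at most \<open>p\<close>. Hence the bounds for \<open>s\<close> and \<open>eta\<close>
  pass from \<open>m'\<close> to \<open>m\<close>. For lengths divisible by \<open>m n\<close> one
  block is missing: the \<open>3 p - 2\<close> terms left at the end are too few for Reiher's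
  theorem, but three linear conditions modulo \<open>p\<close> can still be met, so there is a block
  with product in \<open>H\<close> and total weight divisible by \<open>p\<close>. Its length may
  exceed \<open>p\<close>, so its product counts for more than one term: hence the weights and the
  distinguished term \<open>z\<close>. The induction runs on exponents, and all it keeps of the
  group is \<open>s ^ m = 1\<close> modulo \<open>m n\<close>. Passing to \<open>H\<close> replaces
  \<open>s\<close> by \<open>s ^ p\<close>, and the congruence survives with \<open>m'\<close> for
  \<open>m\<close>, so no subgroup or quotient has to be constructed.\<close>

lemma sum_Pow_insert:
  fixes h :: "'i set \<Rightarrow> 'b::comm_monoid_add"
  assumes "finite K" "t \<notin> K"
  shows "(\<Sum>T\<in>{T\<in>Pow (insert t K). t \<in> T}. h T) = (\<Sum>T\<in>Pow K. h (insert t T))"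
  by (rule sum.reindex_bij_witness[of _ "insert t" "\<lambda>T. T - {t}"]) (use assms in \<open>auto simp: insert_absorb\<close>)

lemma sum_alternating_Pow:
  assumes "finite J" "J \<noteq> {}"
  shows "(\<Sum>T\<in>Pow J. (-1::int) ^ card T) = 0"
proof -
  obtain t K where J: "J = insert t K" "t \<notin> K"
    using assms(2) by (meson Set.set_insert ex_in_conv)
  with assms have K: "finite K" by simp
  have "(\<Sum>T\<in>Pow J. (-1::int) ^ card T) =
    (\<Sum>T\<in>Pow K. (-1) ^ card T) + (\<Sum>T\<in>{T\<in>Pow J. t \<in> T}. (-1) ^ card T)"
    using J K by (subst sum.union_disjoint[symmetric]) (auto intro!: sum.cong)
  also have "(\<Sum>T\<in>{T\<in>Pow J. t \<in> T}. (-1::int) ^ card T) = (\<Sum>T\<in>Pow K. (-1) ^ card (insert t T))"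
    unfolding J(1) by (rule sum_Pow_insert[OF K J(2)])
  also have "\<dots> = (\<Sum>T\<in>Pow K. - ((-1) ^ card T))"
  proof (rule sum.cong)
    fix T assume "T \<in> Pow K"
    then have "finite T" "t \<notin> T" using K J(2) finite_subset by auto
    then show "(-1::int) ^ card (insert t T) = - ((-1) ^ card T)" by simp
  qed simp
  finally show ?thesis by (simp add: sum_negf)
qed

text \<open>A product of \<open>d\<close> affine forms is a polynomial of degree \<open>d\<close> in the indicator variables of \<open>T\<close>,
  and the iterated finite difference over more than \<open>d\<close> variables annihilates it.\<close>

lemma sum_alternating_affine:
  fixes F :: "(int \<times> ('i \<Rightarrow> int)) list"
  assumes "finite J" "length F < card J"
  shows "(\<Sum>T\<in>Pow J. (-1) ^ card T * (\<Prod>(c, f)\<leftarrow>F. c + sum f T)) = 0"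
  using assms
proof (induction "length F" arbitrary: F J)
  case 0
  then show ?case using sum_alternating_Pow[of J] by (cases "J = {}") auto
next
  case (Suc n)
  then obtain c f F' where F: "F = (c, f) # F'" "length F' = n"
    by (metis length_Suc_conv surj_pair)
  let ?P = "\<lambda>F T. \<Prod>(c, f)\<leftarrow>F. c + sum f T"
  have fin: "finite J" by fact
  have inner: "(\<Sum>T\<in>{T\<in>Pow J. t \<in> T}. (-1) ^ card T * ?P F' T) = 0" if "t \<in> J" for t
  proof -
    define K where "K = J - {t}"
    have K: "J = insert t K" "t \<notin> K" "finite K" "length F' < card K"
      using that fin Suc.prems F by (auto simp: K_def)
    \<comment> \<open>All sets concerned contain \<open>t\<close>, so its contribution
      \<open>g t\<close> moves into the constant term.\<close>
    let ?F = "map (\<lambda>(c, g). (c + g t, g)) F'"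
    have "(\<Sum>T\<in>{T\<in>Pow J. t \<in> T}. (-1) ^ card T * ?P F' T)
      = (\<Sum>T\<in>Pow K. (-1) ^ card (insert t T) * ?P F' (insert t T))"
      unfolding K(1) by (rule sum_Pow_insert[OF K(3,2)])
    also have "\<dots> = (\<Sum>T\<in>Pow K. - ((-1) ^ card T * ?P ?F T))"
    proof (rule sum.cong)
      fix T assume "T \<in> Pow K"
      then have "finite T" "t \<notin> T" using K finite_subset by auto
      then show "(-1) ^ card (insert t T) * ?P F' (insert t T) = - ((-1) ^ card T * ?P ?F T)"
        by (simp add: comp_def case_prod_unfold add.assoc)
    qed simp
    also have "\<dots> = 0"
      using Suc.hyps(1)[of ?F K] K F by (simp add: sum_negf)
    finally show ?thesis .
  qed
  \<comment> \<open>Expanding the first factor leaves a multiple of the sum for \<open>F'\<close>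
    and, for each \<open>t\<close>, a sum over the sets containing \<open>t\<close>, which vanishes
    by \<open>inner\<close>.\<close>
  have "(\<Sum>T\<in>Pow J. (-1) ^ card T * ?P F T)
     = c * (\<Sum>T\<in>Pow J. (-1) ^ card T * ?P F' T)
     + (\<Sum>T\<in>Pow J. \<Sum>t\<in>J. if t \<in> T then f t * ((-1) ^ card T * ?P F' T) else 0)"
    unfolding sum_distrib_left sum.distrib[symmetric]
  proof (rule sum.cong)
    fix T assume "T \<in> Pow J"
    then have T: "J \<inter> T = T" by auto
    show "(-1) ^ card T * ?P F T = c * ((-1) ^ card T * ?P F' T)
        + (\<Sum>t\<in>J. if t \<in> T then f t * ((-1) ^ card T * ?P F' T) else 0)"
      unfolding sum.inter_restrict[OF fin, symmetric] T sum_distrib_right[symmetric]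
      by (simp add: F algebra_simps)
  qed simp
  also have "(\<Sum>T\<in>Pow J. \<Sum>t\<in>J. if t \<in> T then f t * ((-1) ^ card T * ?P F' T) else 0)
    = (\<Sum>t\<in>J. f t * (\<Sum>T\<in>{T\<in>Pow J. t \<in> T}. (-1) ^ card T * ?P F' T))"
    unfolding sum_distrib_left
    by (subst sum.swap, rule sum.cong[OF refl], rule sum.inter_filter[symmetric]) (use fin in simp)
  also have "\<dots> = 0" using inner by simp
  also have "(\<Sum>T\<in>Pow J. (-1) ^ card T * ?P F' T) = 0"
    using Suc.hyps(1)[of F' J] Suc.prems F by simp
  finally show ?case by simp
qed

text \<open>The polynomial \<open>(u + 1) ... (u + p - 1)\<close> replaces
  \<open>1 - u ^ (p - 1)\<close>: it comes already split into affine factors, as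
  \<open>sum_alternating_affine\<close> requires.\<close>

definition nonzero_poly :: "nat \<Rightarrow> int \<Rightarrow> int" where
  "nonzero_poly p u = (\<Prod>c\<leftarrow>[1..<p]. int c + u)"

lemma dvd_nonzero_poly:
  assumes "prime p" "\<not> int p dvd u"
  shows "int p dvd nonzero_poly p u"
proof -
  define c where "c = nat ((- u) mod int p)"
  have p: "p > 0" using assms(1) prime_gt_0_nat by blast
  have c: "int c = (- u) mod int p" using p by (simp add: c_def)
  then have "c < p" using p by (metis of_nat_0_less_iff of_nat_less_iff pos_mod_bound)
  have d: "int p dvd int c + u" unfolding c
    by (metis add.commute add.right_inverse dvd_eq_mod_eq_0 mod_0 mod_add_right_eq)
  then have "c \<noteq> 0" using assms(2) by (metis add_0 of_nat_0)
  with \<open>c < p\<close> have "c \<in> set [1..<p]" by auto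
  then have "int c + u dvd nonzero_poly p u"
    unfolding nonzero_poly_def by (intro prod_list_dvd) auto
  then show ?thesis using d dvd_trans by blast
qed

lemma cong_nonzero_poly:
  assumes "int p dvd u"
  shows "[nonzero_poly p u = fact (p - 1)] (mod int p)"
proof -
  have "[(\<Prod>c\<leftarrow>cs. int c + u) = (\<Prod>c\<leftarrow>cs. int c)] (mod int p)" for cs
  proof (induction cs)
    case (Cons c cs)
    have "[int c + u = int c] (mod int p)" using assms by (simp add: cong_iff_dvd_diff)
    then show ?case using Cons by (simp add: cong_mult)
  qed simp
  moreover have "(\<Prod>c\<leftarrow>[1..<p]. int c) = fact (p - 1)"
  proof -
    have "(\<Prod>c\<leftarrow>[1..<p]. int c) = prod int {1..<p}"
      using prod.distinct_set_conv_list[of "[1..<p]" int] by simp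
    also have "{1..<p} = {1..p - 1}" by auto
    finally show ?thesis by (simp add: fact_prod)
  qed
  ultimately show ?thesis unfolding nonzero_poly_def by metis
qed

text \<open>The Chevalley--Warning argument: modulo \<open>p\<close>, a constant multiple of the indicator of \<open>p dvd u\<close>
  is the polynomial \<open>nonzero_poly p u\<close> of degree \<open>p - 1\<close>.\<close>

lemma alternating_count:
  fixes F :: "(int \<times> ('i \<Rightarrow> int)) list"
  assumes p: "prime p" and J: "finite J" and len: "length F * (p - 1) < card J"
  shows "int p dvd (\<Sum>T | T \<subseteq> J \<and> (\<forall>(c, f)\<in>set F. int p dvd c + sum f T). (-1) ^ card T)"
proof -
  let ?ok = "\<lambda>F T. \<forall>(c, f)\<in>set F. int p dvd c + sum f T"
  let ?D = "\<lambda>F T. \<Prod>(c, f)\<leftarrow>F. nonzero_poly p (c + sum f T)"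
  \<comment> \<open>Each \<open>nonzero_poly\<close> is split into its \<open>p - 1\<close> affine
    factors, so \<open>len\<close> becomes the degree condition.\<close>
  define FF where "FF = concat (map (\<lambda>(c, f). map (\<lambda>d. (int d + c, f)) [1..<p]) F)"
  have "length FF = length F * (p - 1)"
    unfolding FF_def by (induction F) (auto simp: length_concat)
  then have "(\<Sum>T\<in>Pow J. (-1) ^ card T * (\<Prod>(c, f)\<leftarrow>FF. c + sum f T)) = 0"
    using len J by (intro sum_alternating_affine) auto
  moreover have "(\<Prod>(c, f)\<leftarrow>FF. c + sum f T) = ?D F T" for T
    unfolding FF_def
    by (induction F) (auto simp: nonzero_poly_def comp_def add.assoc)
  ultimately have zero: "(\<Sum>T\<in>Pow J. (-1) ^ card T * ?D F T) = 0" by simp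
  have D: "[?D F T = (if ?ok F T then fact (p - 1) ^ length F else 0)] (mod int p)" for T
  proof (induction F)
    case (Cons cf F)
    obtain c f where cf: "cf = (c, f)" by force
    show ?case
    proof (cases "int p dvd c + sum f T")
      case True
      then have ok: "?ok (cf # F) T \<longleftrightarrow> ?ok F T" by (simp add: cf)
      have "(if ?ok (cf # F) T then fact (p - 1) ^ length (cf # F) else 0)
        = fact (p - 1) * (if ?ok F T then fact (p - 1) ^ length F else (0::int))"
        unfolding ok by simp
      moreover have "?D (cf # F) T = nonzero_poly p (c + sum f T) * ?D F T" by (simp add: cf)
      ultimately show ?thesis
        using cong_mult[OF cong_nonzero_poly[OF True] Cons.IH] by (simp only:)
    next
      case False
      have "int p dvd ?D (cf # F) T"
        using dvd_nonzero_poly[OF p False] by (simp add: cf)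
      then show ?thesis using False by (simp add: cf cong_0_iff)
    qed
  qed simp
  let ?S = "\<Sum>T | T \<subseteq> J \<and> ?ok F T. (-1::int) ^ card T"
  have "[(\<Sum>T\<in>Pow J. (-1) ^ card T * ?D F T)
      = (\<Sum>T\<in>Pow J. (-1) ^ card T * (if ?ok F T then fact (p - 1) ^ length F else 0))] (mod int p)"
    by (intro cong_sum cong_mult D) simp
  also have "(\<Sum>T\<in>Pow J. (-1) ^ card T * (if ?ok F T then fact (p - 1) ^ length F else 0))
      = (\<Sum>T\<in>Pow J. if ?ok F T then (-1::int) ^ card T * fact (p - 1) ^ length F else 0)"
    by (rule sum.cong) auto
  also have "\<dots> = (\<Sum>T | T \<in> Pow J \<and> ?ok F T. (-1) ^ card T * fact (p - 1) ^ length F)"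
    by (rule sum.inter_filter[symmetric]) (use J in simp)
  also have "\<dots> = ?S * fact (p - 1) ^ length F"
    by (simp add: sum_distrib_right)
  finally have "[?S * fact (p - 1) ^ length F = 0] (mod int p)"
    unfolding zero by (rule cong_sym)
  then have "int p dvd ?S * fact (p - 1) ^ length F"
    by (simp only: cong_0_iff)
  \<comment> \<open>The surviving constant is a power of \<open>(p - 1)!\<close>, hence invertible
    modulo \<open>p\<close>.\<close>
  moreover have "\<not> int p dvd fact (p - 1) ^ length F"
  proof
    assume "int p dvd fact (p - 1) ^ length F"
    then have "int p dvd int (fact (p - 1))"
      using p prime_dvd_power[of "int p"] by auto
    then have "p dvd fact (p - 1)" by (simp only: int_dvd_int_iff)
    then show False using p prime_dvd_fact_iff[of p "p - 1"] prime_gt_0_nat[of p] by auto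
  qed
  ultimately show ?thesis using p prime_dvd_mult_iff[of "int p"] by auto
qed

text \<open>The upper bound for the Davenport constant of an elementary abelian
  \<open>p\<close>-group: were the empty set the only solution, the alternating count would be
  1.\<close>

lemma exists_zero_sum_subset:
  fixes F :: "('i \<Rightarrow> int) list"
  assumes p: "prime p" and J: "finite J" and len: "length F * (p - 1) < card J"
  obtains T where "T \<subseteq> J" "T \<noteq> {}" "\<And>f. f \<in> set F \<Longrightarrow> int p dvd sum f T"
proof -
  let ?F = "map (Pair 0) F"
  let ?A = "{T. T \<subseteq> J \<and> (\<forall>(c, f)\<in>set ?F. int p dvd c + sum f T)}"
  have "?A \<noteq> {{}}"
  proof
    assume A: "?A = {{}}"
    have "int p dvd (\<Sum>T\<in>?A. (-1) ^ card T)"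
      using len by (intro alternating_count[OF p J]) simp
    then have "int p dvd 1" unfolding A by simp
    then show False using p not_prime_unit by fastforce
  qed
  moreover have "{} \<in> ?A" by auto
  ultimately obtain T where "T \<in> ?A" "T \<noteq> {}" by blast
  then show thesis by (intro that[of T]) auto
qed

text \<open>A case of Lucas' theorem. Splitting \<open>p\<close> elements off by Vandermonde, only
  the terms \<open>k = 0\<close> and \<open>k = p\<close> survive modulo \<open>p\<close>, and each
  step adds 1.\<close>

lemma cong_choose_prime:
  assumes "prime p"
  shows "[int (N choose p) = int (N div p)] (mod int p)"
proof (induction N rule: less_induct)
  case (less N)
  have p: "p > 0" using assms prime_gt_0_nat by blast
  show ?case
  proof (cases "N < p")
    case False
    define M where "M = N - p"
    have N: "N = p + M" using False by (simp add: M_def)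
    have "(N choose p) = (\<Sum>k\<le>p. (p choose k) * (M choose (p - k)))"
      unfolding N by (rule vandermonde[symmetric])
    also have "{..p} = insert 0 (insert p {1..<p})" using p by auto
    finally have e: "(N choose p) = (M choose p) + (1 + (\<Sum>k\<in>{1..<p}. (p choose k) * (M choose (p - k))))"
      using p by simp
    have "p dvd (\<Sum>k\<in>{1..<p}. (p choose k) * (M choose (p - k)))"
      using assms by (intro dvd_sum dvd_mult2 dvd_choose_prime) auto
    then obtain r where r: "(\<Sum>k\<in>{1..<p}. (p choose k) * (M choose (p - k))) = p * r" by blast
    have "[int (N choose p) = int (M choose p) + 1] (mod int p)"
      unfolding e r by (simp add: cong_iff_dvd_diff)
    also have "[int (M choose p) + 1 = int (M div p) + 1] (mod int p)"
      using p N by (intro cong_add less.IH) auto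
    also have "int (M div p) + 1 = int (N div p)" using p N by simp
    finally show ?thesis .
  qed (simp add: binomial_eq_0)
qed

section \<open>Reiher's theorem\<close>

text \<open>The functions \<open>a\<close> and \<open>b\<close> are coordinates in
  \<open>C_p x C_p\<close>. Working with indices keeps equal terms distinct, so that subsets count
  subsequences with multiplicity.\<close>

definition zero_sum :: "nat \<Rightarrow> ('i \<Rightarrow> int) \<Rightarrow> ('i \<Rightarrow> int) \<Rightarrow> 'i set \<Rightarrow> bool" where
  "zero_sum p a b T \<longleftrightarrow> int p dvd sum a T \<and> int p dvd sum b T"

definition zsets :: "nat \<Rightarrow> ('i \<Rightarrow> int) \<Rightarrow> ('i \<Rightarrow> int) \<Rightarrow> nat \<Rightarrow> 'i set \<Rightarrow> 'i set set" where
  "zsets p a b k J = {T. T \<subseteq> J \<and> card T = k \<and> zero_sum p a b T}"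

abbreviation zcount :: "nat \<Rightarrow> ('i \<Rightarrow> int) \<Rightarrow> ('i \<Rightarrow> int) \<Rightarrow> nat \<Rightarrow> 'i set \<Rightarrow> int" where
  "zcount p a b k J \<equiv> int (card (zsets p a b k J))"

lemma finite_zsets: "finite J \<Longrightarrow> finite (zsets p a b k J)"
  by (rule finite_subset[of _ "Pow J"]) (auto simp: zsets_def)

lemma zsets_0: "finite J \<Longrightarrow> zsets p a b 0 J = {{}}"
  using finite_subset by (fastforce simp: zsets_def zero_sum_def)

lemma zsets_cong:
  assumes "\<And>i. i \<in> J \<Longrightarrow> a i = a' i" "\<And>i. i \<in> J \<Longrightarrow> b i = b' i"
  shows "zsets p a b k J = zsets p a' b' k J"
proof -
  have "sum a T = sum a' T" "sum b T = sum b' T" if "T \<subseteq> J" for T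
    using that assms by (auto intro!: sum.cong)
  then show ?thesis by (auto simp: zsets_def zero_sum_def)
qed

lemma zero_sum_Un:
  assumes "finite A" "finite B" "A \<inter> B = {}" "zero_sum p a b A"
  shows "zero_sum p a b (A \<union> B) \<longleftrightarrow> zero_sum p a b B"
  using assms by (simp add: zero_sum_def sum.union_disjoint dvd_add_right_iff)

lemma zero_sum_Diff:
  assumes "finite A" "B \<subseteq> A" "zero_sum p a b A"
  shows "zero_sum p a b (A - B) \<longleftrightarrow> zero_sum p a b B"
proof -
  have "sum f (A - B) = sum f A - sum f B" for f :: "'a \<Rightarrow> int"
    using assms by (simp add: sum_diff)
  then show ?thesis using assms(3) by (auto simp: zero_sum_def dvd_diff_right_iff)
qed

text \<open>An index carrying the zero vector acts as a dummy: a set using it is a zero-sum set of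
  size one less.\<close>

lemma card_zsets_insert:
  assumes "finite J" "j \<notin> J" "a j = 0" "b j = 0"
  shows "card (zsets p a b (Suc k) (insert j J)) = card (zsets p a b (Suc k) J) + card (zsets p a b k J)"
proof -
  have zs: "zero_sum p a b (insert j T) \<longleftrightarrow> zero_sum p a b T"
    and card: "card (insert j T) = Suc (card T)" if "T \<subseteq> J" for T
  proof -
    from that assms have "finite T" "j \<notin> T" using finite_subset by auto
    then show "zero_sum p a b (insert j T) \<longleftrightarrow> zero_sum p a b T" "card (insert j T) = Suc (card T)"
      using assms by (simp_all add: zero_sum_def)
  qed
  have "zsets p a b (Suc k) (insert j J) = zsets p a b (Suc k) J \<union> insert j ` zsets p a b k J"
  proof (intro equalityI subsetI)
    fix T assume T: "T \<in> zsets p a b (Suc k) (insert j J)"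
    show "T \<in> zsets p a b (Suc k) J \<union> insert j ` zsets p a b k J"
    proof (cases "j \<in> T")
      case True
      then have "T = insert j (T - {j})" "T - {j} \<subseteq> J" using T by (auto simp: zsets_def)
      with T zs[of "T - {j}"] card[of "T - {j}"] have "T - {j} \<in> zsets p a b k J"
        by (auto simp: zsets_def)
      then show ?thesis using \<open>T = insert j (T - {j})\<close> by blast
    next
      case False
      then show ?thesis using T by (auto simp: zsets_def)
    qed
  qed (auto simp: zsets_def zs card)
  moreover have "zsets p a b (Suc k) J \<inter> insert j ` zsets p a b k J = {}"
    using assms(2) by (auto simp: zsets_def)
  moreover have "inj_on (insert j) (zsets p a b k J)"
    using assms(2) by (auto simp: inj_on_def zsets_def insert_ident subset_iff)
  ultimately show ?thesis
    using assms(1) by (simp add: card_Un_disjoint finite_zsets card_image)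
qed

lemma card_supersets:
  assumes "finite X" "T \<subseteq> X" "M \<le> card X"
  shows "card {J. T \<subseteq> J \<and> J \<subseteq> X \<and> card J = M} = (card X - card T) choose (card X - M)"
proof -
  have "card (X - J) = card X - card J" if "J \<subseteq> X" for J
    using that assms(1) by (simp add: card_Diff_subset finite_subset)
  note card = this
  have "bij_betw (\<lambda>J. X - J) {J. T \<subseteq> J \<and> J \<subseteq> X \<and> card J = M} {C. C \<subseteq> X - T \<and> card C = card X - M}"
    by (rule bij_betw_byWitness[of _ "\<lambda>J. X - J"])
       (use assms card_mono[OF assms(1)] in \<open>auto simp: card card[OF subset_trans[OF _ Diff_subset[of X T]]] double_diff\<close>)
  then have "card {J. T \<subseteq> J \<and> J \<subseteq> X \<and> card J = M} = card {C. C \<subseteq> X - T \<and> card C = card X - M}"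
    by (rule bij_betw_same_card)
  also have "\<dots> = (card X - card T) choose (card X - M)"
    using assms by (simp add: n_subsets card_Diff_subset finite_subset)
  finally show ?thesis .
qed

text \<open>Double counting of the pairs \<open>T \<subseteq> J\<close>: each \<open>T\<close> lies
  in equally many sets \<open>J\<close> of size \<open>M\<close>.\<close>

lemma sum_card_zsets:
  assumes "finite X" "M \<le> card X"
  shows "(\<Sum>J | J \<subseteq> X \<and> card J = M. card (zsets p a b k J))
    = ((card X - k) choose (card X - M)) * card (zsets p a b k X)"
proof -
  have fin: "finite {J. J \<subseteq> X \<and> P J}" for P using assms(1) by simp
  have "(\<Sum>J | J \<subseteq> X \<and> card J = M. card (zsets p a b k J))
      = (\<Sum>J | J \<subseteq> X \<and> card J = M. card {T \<in> zsets p a b k X. T \<subseteq> J})"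
    by (intro sum.cong arg_cong[of _ _ card]) (auto simp: zsets_def)
  also have "\<dots> = (\<Sum>T\<in>zsets p a b k X. card {J \<in> {J. J \<subseteq> X \<and> card J = M}. T \<subseteq> J})"
    unfolding card_eq_sum using assms fin finite_zsets[of X p a b k]
    by (subst (1 2) sum.inter_filter) (auto intro: sum.swap)
  also have "\<dots> = (\<Sum>T\<in>zsets p a b k X. (card X - k) choose (card X - M))"
  proof (rule sum.cong)
    fix T assume "T \<in> zsets p a b k X"
    then have T: "T \<subseteq> X" "card T = k" by (auto simp: zsets_def)
    have "{J \<in> {J. J \<subseteq> X \<and> card J = M}. T \<subseteq> J} = {J. T \<subseteq> J \<and> J \<subseteq> X \<and> card J = M}" by auto
    then show "card {J \<in> {J. J \<subseteq> X \<and> card J = M}. T \<subseteq> J} = (card X - k) choose (card X - M)"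
      using card_supersets[OF assms(1) T(1) assms(2)] T(2) by simp
  qed simp
  finally show ?thesis by simp
qed

text \<open>The size enters as a third form, with all coefficients 1 and shift \<open>c\<close>,
  which selects a residue class of sizes. Three forms account for
  \<open>3 * (p - 1)\<close>.\<close>

lemma alternating_zcount:
  assumes p: "prime p" and J: "finite J" and len: "3 * (p - 1) < card J"
  shows "int p dvd (\<Sum>k | k \<le> card J \<and> int p dvd c + int k. (-1) ^ k * zcount p a b k J)"
proof -
  let ?F = "[(0, a), (0, b), (c, \<lambda>_. 1)]"
  let ?S = "{T. T \<subseteq> J \<and> (\<forall>(c, f)\<in>set ?F. int p dvd c + sum f T)}"
  let ?K = "{k. k \<le> card J \<and> int p dvd c + int k}"
  have S: "?S = {T. T \<subseteq> J \<and> zero_sum p a b T \<and> int p dvd c + int (card T)}"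
    by (auto simp: zero_sum_def)
  have "int p dvd (\<Sum>T\<in>?S. (-1) ^ card T)"
    by (rule alternating_count[OF p J]) (use len in simp)
  also have "(\<Sum>T\<in>?S. (-1::int) ^ card T) = (\<Sum>k\<in>?K. \<Sum>T\<in>{T\<in>?S. card T = k}. (-1) ^ card T)"
  proof (rule sum.group[symmetric])
    show "finite ?S" using J by simp
    show "card ` ?S \<subseteq> ?K" unfolding S using J by (auto intro: card_mono)
  qed simp
  also have "\<dots> = (\<Sum>k\<in>?K. (-1) ^ k * zcount p a b k J)"
  proof (rule sum.cong)
    fix k assume "k \<in> ?K"
    then have "{T\<in>?S. card T = k} = zsets p a b k J" unfolding S by (auto simp: zsets_def)
    then have "(\<Sum>T\<in>{T\<in>?S. card T = k}. (-1::int) ^ card T) = (\<Sum>T\<in>zsets p a b k J. (-1) ^ k)"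
      by (intro sum.cong) (auto simp: zsets_def)
    then show "(\<Sum>T\<in>{T\<in>?S. card T = k}. (-1::int) ^ card T) = (-1) ^ k * zcount p a b k J"
      by simp
  qed simp
  finally show ?thesis .
qed

section \<open>Congruences between zero-sum counts for odd primes\<close>

locale odd_prime =
  fixes p :: nat
  assumes prime: "prime p" and ge3: "3 \<le> p"
begin

lemma odd_p: "odd p"
  using prime ge3 prime_odd_nat by auto

text \<open>Below \<open>3 * p\<close> only the sizes \<open>0\<close>, \<open>p\<close> and
  \<open>2 * p\<close> are multiples of \<open>p\<close>; the signs come from \<open>p\<close> being
  odd.\<close>

lemma zcount_small:
  assumes "finite J" "card J = 3 * p - 2 \<or> card J = 3 * p - 1"
  shows "int p dvd 1 - zcount p a b p J + zcount p a b (2 * p) J"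
proof -
  let ?K = "{k. k \<le> card J \<and> int p dvd 0 + int k}"
  have "?K = {0, p, 2 * p}"
  proof (intro equalityI subsetI)
    fix k assume "k \<in> ?K"
    then have "p dvd k" "k < p * 3" using assms(2) ge3 by auto
    then obtain r where r: "k = p * r" "p * r < p * 3" by blast
    then have "r < 3" by (metis mult_less_cancel1)
    then have "r = 0 \<or> r = 1 \<or> r = 2" by auto
    then show "k \<in> {0, p, 2 * p}" using r by auto
  qed (use assms ge3 in auto)
  moreover have "int p dvd (\<Sum>k\<in>?K. (-1) ^ k * zcount p a b k J)"
    using assms ge3 by (intro alternating_zcount prime) auto
  ultimately show ?thesis
    using ge3 odd_p assms(1) by (simp add: zsets_0 algebra_simps)
qed

text \<open>Here \<open>J\<close> is one element too small for \<open>zcount_small\<close>. A dummy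
  zero at \<open>j\<close> makes up for it, and the sets through \<open>j\<close> produce the sizes
  \<open>p - 1\<close> and \<open>2 * p - 1\<close>.\<close>

lemma zcount_3p_minus_3:
  assumes "finite J" "card J = 3 * p - 3" "j \<notin> J"
  shows "int p dvd 1 - zcount p a b p J - zcount p a b (p - 1) J
    + zcount p a b (2 * p) J + zcount p a b (2 * p - 1) J"
proof -
  let ?a = "a(j := 0)" and ?b = "b(j := 0)"
  have eq: "zsets p ?a ?b k J = zsets p a b k J" for k
    using assms(3) by (intro zsets_cong) auto
  have "int p dvd 1 - zcount p ?a ?b p (insert j J) + zcount p ?a ?b (2 * p) (insert j J)"
    using assms ge3 by (intro zcount_small) auto
  moreover have "zcount p ?a ?b (Suc k) (insert j J) = zcount p a b (Suc k) J + zcount p a b k J" for k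
    using card_zsets_insert[of J j ?a ?b p k] assms by (simp add: eq)
  from this[of "p - 1"] this[of "2 * p - 1"]
  have "zcount p ?a ?b p (insert j J) = zcount p a b p J + zcount p a b (p - 1) J"
    "zcount p ?a ?b (2 * p) (insert j J) = zcount p a b (2 * p) J + zcount p a b (2 * p - 1) J"
    using ge3 by simp_all
  ultimately show ?thesis by (simp add: algebra_simps)
qed

text \<open>Alon--Dubiner: after the removal of one term, the complement in \<open>T\<close> of a zero-sum subset
  of size \<open>2 p\<close> is one of size \<open>p\<close>.\<close>

lemma zsets_3p:
  assumes X: "finite X" and empty: "zsets p a b p X = {}"
  shows "zsets p a b (3 * p) X = {}"
proof (rule ccontr)
  assume "zsets p a b (3 * p) X \<noteq> {}"
  then obtain T where T: "T \<subseteq> X" "card T = 3 * p" "zero_sum p a b T" by (auto simp: zsets_def)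
  then have fin: "finite T" using X finite_subset by blast
  obtain t where t: "t \<in> T" using T(2) ge3 by (metis card.empty ex_in_conv mult_eq_0_iff not_numeral_le_zero zero_neq_numeral)
  let ?J = "T - {t}"
  have "zsets p a b p ?J = {}" using empty T(1) by (auto simp: zsets_def)
  moreover have "int p dvd 1 - zcount p a b p ?J + zcount p a b (2 * p) ?J"
    using fin t T(2) by (intro zcount_small) auto
  ultimately have "zsets p a b (2 * p) ?J \<noteq> {}" using ge3 by auto
  then obtain C where C: "C \<subseteq> T" "card C = 2 * p" "zero_sum p a b C" by (auto simp: zsets_def)
  have "zero_sum p a b (T - C)" using zero_sum_Diff[OF fin C(1) T(3)] C(3) by simp
  moreover have "card (T - C) = p" using C T fin by (simp add: card_Diff_subset finite_subset)
  ultimately have "T - C \<in> zsets p a b p X" using T(1) by (auto simp: zsets_def)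
  then show False using empty by simp
qed

context
  fixes X :: "'i set" and a b :: "'i \<Rightarrow> int"
  assumes X: "finite X" and card_X: "card X = 4 * p - 3"
begin

lemma zcount_multiples: "int p dvd 1 - zcount p a b p X + zcount p a b (2 * p) X - zcount p a b (3 * p) X"
proof -
  let ?K = "{k. k \<le> card X \<and> int p dvd 0 + int k}"
  have "?K = {0, p, 2 * p, 3 * p}"
  proof (intro equalityI subsetI)
    fix k assume "k \<in> ?K"
    then have "p dvd k" "k < p * 4" using card_X ge3 by auto
    then obtain r where r: "k = p * r" "p * r < p * 4" by blast
    then have "r < 4" by (metis mult_less_cancel1)
    then have "r = 0 \<or> r = 1 \<or> r = 2 \<or> r = 3" by auto
    then show "k \<in> {0, p, 2 * p, 3 * p}" using r by auto
  qed (use card_X ge3 in auto)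
  moreover have "int p dvd (\<Sum>k\<in>?K. (-1) ^ k * zcount p a b k X)"
    using X card_X ge3 by (intro alternating_zcount prime) auto
  ultimately show ?thesis
    using ge3 odd_p X by (simp add: zsets_0 algebra_simps)
qed

text \<open>The shift \<open>c = 1\<close> selects the sizes congruent to \<open>-1\<close> modulo
  \<open>p\<close>.\<close>

lemma zcount_multiples_minus_1:
  "int p dvd zcount p a b (p - 1) X - zcount p a b (2 * p - 1) X + zcount p a b (3 * p - 1) X"
proof -
  let ?K = "{k. k \<le> card X \<and> int p dvd 1 + int k}"
  have "?K = {p - 1, 2 * p - 1, 3 * p - 1}"
  proof (intro equalityI subsetI)
    fix k assume k: "k \<in> ?K"
    then have "int p dvd int (k + 1)" by (simp add: add.commute)
    then have "p dvd k + 1" by (simp only: int_dvd_int_iff)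
    then obtain r where r: "k + 1 = p * r" by blast
    have "k + 1 < p * 4" using k card_X ge3 by auto
    then have "p * r < p * 4" by (simp only: r)
    then have "r < 4" by (metis mult_less_cancel1)
    moreover have "r \<noteq> 0" using r by (metis add_is_0 mult_0_right one_neq_zero)
    ultimately have "r = 1 \<or> r = 2 \<or> r = 3" by auto
    then show "k \<in> {p - 1, 2 * p - 1, 3 * p - 1}" using r by auto
  next
    fix k assume "k \<in> {p - 1, 2 * p - 1, 3 * p - 1}"
    then have "1 + int k \<in> {int p, 2 * int p, 3 * int p} \<and> k \<le> card X" using ge3 card_X by auto
    then show "k \<in> ?K" by auto
  qed
  moreover have "int p dvd (\<Sum>k\<in>?K. (-1) ^ k * zcount p a b k X)"
    using X card_X ge3 by (intro alternating_zcount prime) auto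
  moreover have "even (p - 1)" "odd (2 * p - 1)" "even (3 * p - 1)"
    using ge3 odd_p by auto
  moreover have "p - 1 \<noteq> 2 * p - 1" "p - 1 \<noteq> 3 * p - 1" "2 * p - 1 \<noteq> 3 * p - 1" using ge3 by auto
  ultimately show ?thesis by (simp add: algebra_simps)
qed

text \<open>Sum \<open>zcount_3p_minus_3\<close> over all subsets of size \<open>3 * p - 3\<close>.
  The multiplicities \<open>(4 * p - 3 - k) choose p\<close> reduce to the quotients
  \<open>(4 * p - 3 - k) div p\<close>, which are the coefficients 3, 2, 2, 1, 1.\<close>

lemma zcount_double:
  "int p dvd 3 - 2 * zcount p a b p X - 2 * zcount p a b (p - 1) X
    + zcount p a b (2 * p) X + zcount p a b (2 * p - 1) X"
proof -
  let ?J = "{J. J \<subseteq> X \<and> card J = 3 * p - 3}"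
  have S: "[(\<Sum>J\<in>?J. zcount p a b k J) = int q * zcount p a b k X] (mod int p)"
    if "(4 * p - 3 - k) div p = q" for k q
  proof -
    have "card X - (3 * p - 3) = p" using card_X by simp
    then have "(\<Sum>J\<in>?J. zcount p a b k J) = int ((4 * p - 3 - k) choose p) * zcount p a b k X"
      using sum_card_zsets[OF X, of "3 * p - 3" p a b k] card_X
      by (simp flip: of_nat_sum of_nat_mult)
    then show ?thesis
      using cong_choose_prime[OF prime, of "4 * p - 3 - k"] that by (simp add: cong_mult)
  qed
  have "int p dvd (\<Sum>J\<in>?J. 1 - zcount p a b p J - zcount p a b (p - 1) J
      + zcount p a b (2 * p) J + zcount p a b (2 * p - 1) J)"
  proof (rule dvd_sum)
    fix J assume J: "J \<in> ?J"
    then have "J \<subset> X" using card_X ge3 by auto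
    then obtain j where "j \<notin> J" by auto
    then show "int p dvd 1 - zcount p a b p J - zcount p a b (p - 1) J
        + zcount p a b (2 * p) J + zcount p a b (2 * p - 1) J"
      using J X by (intro zcount_3p_minus_3) (auto intro: finite_subset)
  qed
  also have "(\<Sum>J\<in>?J. 1 - zcount p a b p J - zcount p a b (p - 1) J
      + zcount p a b (2 * p) J + zcount p a b (2 * p - 1) J)
    = (\<Sum>J\<in>?J. zcount p a b 0 J) - (\<Sum>J\<in>?J. zcount p a b p J) - (\<Sum>J\<in>?J. zcount p a b (p - 1) J)
      + (\<Sum>J\<in>?J. zcount p a b (2 * p) J) + (\<Sum>J\<in>?J. zcount p a b (2 * p - 1) J)"
  proof -
    have "(\<Sum>J\<in>?J. zcount p a b 0 J) = (\<Sum>J\<in>?J. 1)"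
      using finite_subset[OF _ X] by (intro sum.cong) (auto simp: zsets_0)
    then show ?thesis by (simp only: sum.distrib sum_subtractf)
  qed
  finally have "[(\<Sum>J\<in>?J. zcount p a b 0 J) - (\<Sum>J\<in>?J. zcount p a b p J) - (\<Sum>J\<in>?J. zcount p a b (p - 1) J)
      + (\<Sum>J\<in>?J. zcount p a b (2 * p) J) + (\<Sum>J\<in>?J. zcount p a b (2 * p - 1) J) = 0] (mod int p)"
    by (simp only: cong_0_iff)
  moreover have "[(\<Sum>J\<in>?J. zcount p a b 0 J) - (\<Sum>J\<in>?J. zcount p a b p J) - (\<Sum>J\<in>?J. zcount p a b (p - 1) J)
      + (\<Sum>J\<in>?J. zcount p a b (2 * p) J) + (\<Sum>J\<in>?J. zcount p a b (2 * p - 1) J)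
    = int 3 * zcount p a b 0 X - int 2 * zcount p a b p X - int 2 * zcount p a b (p - 1) X
      + int 1 * zcount p a b (2 * p) X + int 1 * zcount p a b (2 * p - 1) X] (mod int p)"
    using ge3 by (intro cong_add cong_diff S) (auto intro!: div_nat_eqI)
  ultimately have "[int 3 * zcount p a b 0 X - int 2 * zcount p a b p X - int 2 * zcount p a b (p - 1) X
      + int 1 * zcount p a b (2 * p) X + int 1 * zcount p a b (2 * p - 1) X = 0] (mod int p)"
    using cong_trans cong_sym by blast
  then show ?thesis using X by (simp add: cong_0_iff zsets_0)
qed

text \<open>Reiher's double count of the partitions of \<open>X\<close> into \<open>A\<close>, \<open>B\<close>, \<open>C\<close> of sizes \<open>p - 1\<close>,
  \<open>p - 2\<close> and \<open>2 p\<close> with \<open>A\<close> and \<open>C\<close> zero-sum, first by \<open>A\<close> and then by \<open>B\<close>.\<close>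

lemma zcount_partition:
  assumes empty: "zsets p a b p X = {}"
  shows "[zcount p a b (p - 1) X = zcount p a b (3 * p - 1) X] (mod int p)"
proof -
  let ?A = "zsets p a b (p - 1) X"
  let ?B = "{B. B \<subseteq> X \<and> card B = p - 2 \<and> zero_sum p a b (X - B)}"
  have finB: "finite ?B" using X by simp
  \<comment> \<open>The complements of \<open>A\<close> and of \<open>B\<close> have
    \<open>3 * p - 2\<close> and \<open>3 * p - 1\<close> elements, so \<open>zcount_small\<close>
    applies to both; without zero-sum sets of size \<open>p\<close> it fixes the inner count as
    \<open>-1\<close>.\<close>
  have m1: "[zcount p a b (2 * p) J = - 1] (mod int p)"
    if "J \<subseteq> X" "card J = 3 * p - 2 \<or> card J = 3 * p - 1" for J
  proof -
    have "zsets p a b p J = {}" using empty that(1) by (auto simp: zsets_def)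
    then have "int p dvd 1 + zcount p a b (2 * p) J"
      using zcount_small[of J a b] that X finite_subset by fastforce
    then show ?thesis by (simp add: cong_iff_dvd_diff add.commute)
  qed
  have "[(\<Sum>A\<in>?A. zcount p a b (2 * p) (X - A)) = (\<Sum>A\<in>?A. - 1)] (mod int p)"
    using X card_X ge3 finite_subset[OF _ X]
    by (intro cong_sum m1) (auto simp: zsets_def card_Diff_subset)
  then have 1: "[(\<Sum>A\<in>?A. zcount p a b (2 * p) (X - A)) = - zcount p a b (p - 1) X] (mod int p)"
    by simp
  have "[(\<Sum>B\<in>?B. zcount p a b (2 * p) (X - B)) = (\<Sum>B\<in>?B. - 1)] (mod int p)"
    using X card_X ge3 finite_subset[OF _ X]
    by (intro cong_sum m1) (auto simp: card_Diff_subset)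
  moreover have "card ?B = card (zsets p a b (3 * p - 1) X)"
  proof (rule bij_betw_same_card)
    show "bij_betw (\<lambda>B. X - B) ?B (zsets p a b (3 * p - 1) X)"
      by (rule bij_betw_byWitness[of _ "\<lambda>B. X - B"])
         (use X card_X ge3 finite_subset[OF _ X] in \<open>auto simp: zsets_def card_Diff_subset double_diff\<close>)
  qed
  ultimately have 2: "[(\<Sum>B\<in>?B. zcount p a b (2 * p) (X - B)) = - zcount p a b (3 * p - 1) X] (mod int p)"
    by simp
  let ?PA = "SIGMA A:?A. zsets p a b (2 * p) (X - A)"
  let ?PB = "SIGMA B:?B. zsets p a b (2 * p) (X - B)"
  let ?f = "\<lambda>(A, C). (X - A - C, C)"
  have card3: "card (X - A - C) = card X - card A - card C"
    if "A \<subseteq> X" "C \<subseteq> X - A" for A C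
    using that X finite_subset[OF _ X] by (simp add: card_Diff_subset finite_subset)
  have "bij_betw ?f ?PA ?PB"
  proof (rule bij_betw_byWitness[of _ ?f])
    show "\<forall>x\<in>?PA. ?f (?f x) = x" "\<forall>x\<in>?PB. ?f (?f x) = x" by (auto simp: zsets_def)
    show "?f ` ?PA \<subseteq> ?PB"
    proof (rule image_subsetI)
      fix x assume "x \<in> ?PA"
      then obtain A C where x: "x = (A, C)"
        and AC: "A \<in> ?A" "C \<in> zsets p a b (2 * p) (X - A)" by blast
      then have s: "A \<subseteq> X" "C \<subseteq> X - A" by (auto simp: zsets_def)
      then have e: "X - (X - A - C) = C \<union> A" by auto
      have "zero_sum p a b (C \<union> A)"
        using AC s finite_subset[OF _ X] by (subst zero_sum_Un) (auto simp: zsets_def finite_subset)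
      then have "X - A - C \<in> ?B \<and> C \<in> zsets p a b (2 * p) (X - (X - A - C))"
        using AC s card3[OF s] card_X ge3 e by (auto simp: zsets_def)
      then show "?f x \<in> ?PB" unfolding x by simp
    qed
    show "?f ` ?PB \<subseteq> ?PA"
    proof (rule image_subsetI)
      fix x assume "x \<in> ?PB"
      then obtain B C where x: "x = (B, C)"
        and BC: "B \<in> ?B" "C \<in> zsets p a b (2 * p) (X - B)" by blast
      then have s: "B \<subseteq> X" "C \<subseteq> X - B" by (auto simp: zsets_def)
      then have e: "X - (X - B - C) = C \<union> B" by auto
      have "zero_sum p a b (X - B - C)"
        using BC s X by (subst zero_sum_Diff) (auto simp: zsets_def)
      then have "X - B - C \<in> ?A \<and> C \<in> zsets p a b (2 * p) (X - (X - B - C))"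
        using BC s card3[OF s] card_X ge3 e by (auto simp: zsets_def)
      then show "?f x \<in> ?PA" unfolding x by simp
    qed
  qed
  then have "card ?PA = card ?PB" by (rule bij_betw_same_card)
  then have eq: "(\<Sum>A\<in>?A. zcount p a b (2 * p) (X - A)) = (\<Sum>B\<in>?B. zcount p a b (2 * p) (X - B))"
    using X finB by (simp add: finite_zsets flip: of_nat_sum)
  have "[- zcount p a b (p - 1) X = - zcount p a b (3 * p - 1) X] (mod int p)"
    by (rule cong_trans[OF cong_sym[OF 1] 2[folded eq]])
  then show ?thesis by (simp add: cong_minus_minus_iff)
qed

lemma zsets_p_nonempty: "zsets p a b p X \<noteq> {}"
proof
  assume empty: "zsets p a b p X = {}"
  let ?z = "\<lambda>k. zcount p a b k X"
  have "int p dvd 1 + ?z (2 * p)"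
    using zcount_multiples zsets_3p[OF X empty] empty by simp
  moreover have "int p dvd ?z (p - 1) - ?z (3 * p - 1)"
    using zcount_partition[OF empty] by (simp add: cong_iff_dvd_diff)
  moreover have "int p dvd 3 - 2 * ?z (p - 1) + ?z (2 * p) + ?z (2 * p - 1)"
    using zcount_double empty by simp
  \<comment> \<open>In this combination all counts cancel and only the constant 2 remains.\<close>
  ultimately have "int p dvd (3 - 2 * ?z (p - 1) + ?z (2 * p) + ?z (2 * p - 1)) - (1 + ?z (2 * p))
     + (?z (p - 1) - ?z (2 * p - 1) + ?z (3 * p - 1)) + (?z (p - 1) - ?z (3 * p - 1))"
    using zcount_multiples_minus_1 by (simp only: dvd_add dvd_diff)
  then have "int p dvd 2" by simp
  then show False using ge3 zdvd_imp_le by fastforce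
qed

end

end

theorem Reiher:
  fixes a b :: "'i \<Rightarrow> int"
  assumes p: "prime p" and X: "finite X" "card X = 4 * p - 3"
  obtains T where "T \<subseteq> X" "card T = p" "int p dvd sum a T" "int p dvd sum b T"
proof (cases "p = 2")
  case True
  \<comment> \<open>Five indices fall into four parity classes, and two indices in one class form
    the desired set.\<close>
  let ?f = "\<lambda>i. (a i mod 2, b i mod 2)"
  have "?f ` X \<subseteq> {0, 1} \<times> {0, 1}" by auto
  then have "card (?f ` X) \<le> card ({0, 1::int} \<times> {0, 1::int})" by (intro card_mono) auto
  then have "card (?f ` X) < card X" using True X by simp
  then have "\<not> inj_on ?f X" using pigeonhole by blast
  then obtain i j where ij: "i \<in> X" "j \<in> X" "i \<noteq> j" "a i mod 2 = a j mod 2" "b i mod 2 = b j mod 2"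
    by (auto simp: inj_on_def)
  show thesis
    by (rule that[of "{i, j}"]) (use ij True in \<open>simp_all, presburger+\<close>)
next
  case False
  then interpret odd_prime p
    using p prime_ge_2_nat[OF p] by unfold_locales auto
  show thesis using zsets_p_nonempty[OF X, of a b] that by (auto simp: zsets_def zero_sum_def)
qed

section \<open>Zero-sum sublists over cyclic groups and their squares\<close>

lemma sublist_of_index_set:
  fixes xs :: "'a list"
  assumes "T \<subseteq> {..<length xs}"
  obtains ys where "mset ys \<subseteq># mset xs" "length ys = card T"
    "\<And>f :: 'a \<Rightarrow> nat. sum_list (map f ys) = (\<Sum>i\<in>T. f (xs ! i))"
proof -
  have fin: "finite T" using assms finite_subset by blast
  define ys where "ys = map ((!) xs) (sorted_list_of_set T)"
  have "mset ys = image_mset ((!) xs) (mset_set T)"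
    by (simp add: ys_def flip: sorted_list_of_mset_set)
  also have "\<dots> \<subseteq># image_mset ((!) xs) (mset_set {..<length xs})"
    using assms by (intro image_mset_subseteq_mono subset_imp_msubset_mset_set) auto
  also have "\<dots> = mset (map ((!) xs) [0..<length xs])"
    by (simp flip: lessThan_atLeast0)
  also have "\<dots> = mset xs" by (simp add: map_nth)
  finally have "mset ys \<subseteq># mset xs" .
  moreover have "sum_list (map f ys) = (\<Sum>i\<in>T. f (xs ! i))" for f :: "'a \<Rightarrow> nat"
    using sum.distinct_set_conv_list[of "sorted_list_of_set T" "\<lambda>i. f (xs ! i)"] fin
    by (simp add: ys_def comp_def)
  ultimately show thesis by (intro that[of ys]) (auto simp: ys_def)
qed

lemma zero_sum_sublist:
  fixes F :: "('a \<Rightarrow> nat) list"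
  assumes "prime p" "length F * (p - 1) < length xs"
  obtains ys where "mset ys \<subseteq># mset xs" "ys \<noteq> []" "\<forall>f\<in>set F. p dvd sum_list (map f ys)"
proof -
  let ?F = "map (\<lambda>f i. int (f (xs ! i))) F"
  obtain T where T: "T \<subseteq> {..<length xs}" "T \<noteq> {}" "\<And>g. g \<in> set ?F \<Longrightarrow> int p dvd sum g T"
    using exists_zero_sum_subset[OF assms(1), of "{..<length xs}" ?F] assms(2) by auto
  obtain ys where ys: "mset ys \<subseteq># mset xs" "length ys = card T"
    "\<And>f :: 'a \<Rightarrow> nat. sum_list (map f ys) = (\<Sum>i\<in>T. f (xs ! i))"
    using sublist_of_index_set[OF T(1)] by metis
  show thesis
  proof (rule that[OF ys(1)])
    show "ys \<noteq> []" using ys(2) T(1,2) finite_subset by (metis card_eq_0_iff finite_lessThan list.size(3))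
    show "\<forall>f\<in>set F. p dvd sum_list (map f ys)"
    proof
      fix f assume "f \<in> set F"
      then have "int p dvd (\<Sum>i\<in>T. int (f (xs ! i)))" by (intro T(3)) auto
      then show "p dvd sum_list (map f ys)" by (simp add: ys(3) flip: of_nat_sum)
    qed
  qed
qed

lemma mset_take_subseteq: "mset (take k xs) \<subseteq># mset xs"
proof -
  have "mset xs = mset (take k xs) + mset (drop k xs)"
    by (metis append_take_drop_id mset_append)
  then show ?thesis by simp
qed

lemma Erdos_Ginzburg_Ziv_prime:
  fixes f :: "'a \<Rightarrow> nat"
  assumes p: "prime p" and len: "2 * p - 1 \<le> length xs"
  obtains ys where "mset ys \<subseteq># mset xs" "length ys = p" "p dvd sum_list (map f ys)"
proof -
  have p2: "p \<ge> 2" using p prime_ge_2_nat by blast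
  \<comment> \<open>The constant function 1 forces \<open>p\<close> to divide the length; cutting to
    \<open>2 * p - 1\<close> terms then leaves \<open>p\<close> as the only positive length.\<close>
  let ?zs = "take (2 * p - 1) xs"
  have "length [f, \<lambda>_. 1] * (p - 1) < length ?zs" using len p2 by simp
  then obtain ys where ys: "mset ys \<subseteq># mset ?zs" "ys \<noteq> []"
    "\<forall>g\<in>set [f, \<lambda>_. 1]. p dvd sum_list (map g ys)"
    using zero_sum_sublist[OF p] by blast
  then have "p dvd sum_list (map f ys)" "p dvd length ys" by (simp_all add: sum_list_triv)
  then obtain r where r: "length ys = p * r" by blast
  have "length ys \<le> 2 * p - 1" using size_mset_mono[OF ys(1)] len by simp
  then have "p * r < p * 2" using r p2 by linarith
  then have "r < 2" by (metis mult_less_cancel1)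
  moreover have "r \<noteq> 0" using r ys(2) by (cases r) auto
  ultimately have "length ys = p" using r by (cases "r = 1") auto
  moreover have "mset ys \<subseteq># mset xs"
    using ys(1) mset_take_subseteq subset_mset.trans by blast
  ultimately show thesis using \<open>p dvd sum_list (map f ys)\<close> that by blast
qed

lemma Reiher_list:
  fixes f g :: "'a \<Rightarrow> nat"
  assumes p: "prime p" and len: "4 * p - 3 \<le> length xs"
  obtains ys where "mset ys \<subseteq># mset xs" "length ys = p"
    "p dvd sum_list (map f ys)" "p dvd sum_list (map g ys)"
proof -
  obtain T where T: "T \<subseteq> {..<4 * p - 3}" "card T = p"
    "int p dvd (\<Sum>i\<in>T. int (f (xs ! i)))" "int p dvd (\<Sum>i\<in>T. int (g (xs ! i)))"
    using Reiher[OF p, of "{..<4 * p - 3}" "\<lambda>i. int (f (xs ! i))" "\<lambda>i. int (g (xs ! i))"] by auto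
  have "T \<subseteq> {..<length xs}" using T(1) len by auto
  then obtain ys where ys: "mset ys \<subseteq># mset xs" "length ys = card T"
    "\<And>f :: 'a \<Rightarrow> nat. sum_list (map f ys) = (\<Sum>i\<in>T. f (xs ! i))"
    by (rule sublist_of_index_set) metis
  show thesis
    using T(2-4) ys by (intro that[of ys]) (simp_all flip: of_nat_sum)
qed

text \<open>Padding with \<open>p - 1\<close> zeros reduces the bound \<open>3 p - 2\<close> to the bound \<open>4 p - 3\<close>.\<close>

lemma short_zero_sum_sublist:
  fixes f g :: "'a \<Rightarrow> nat"
  assumes p: "prime p" and len: "3 * p - 2 \<le> length xs"
  obtains ys where "mset ys \<subseteq># mset xs" "ys \<noteq> []" "length ys \<le> p"
    "p dvd sum_list (map f ys)" "p dvd sum_list (map g ys)"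
proof -
  let ?N = "3 * p - 2"
  let ?h = "\<lambda>f i. if i < ?N then int (f (xs ! i)) else 0"
  have p2: "p \<ge> 2" using p prime_ge_2_nat by blast
  obtain T where T: "T \<subseteq> {..<4 * p - 3}" "card T = p"
    "int p dvd sum (?h f) T" "int p dvd sum (?h g) T"
    using Reiher[OF p, of "{..<4 * p - 3}" "?h f" "?h g"] by auto
  let ?T = "T \<inter> {..<?N}"
  have fin: "finite T" using T(1) finite_subset by blast
  have "sum (?h k) T = (\<Sum>i\<in>?T. int (k (xs ! i)))" for k
    using fin by (simp add: sum.inter_restrict)
  with T(3,4) have dvd: "p dvd (\<Sum>i\<in>?T. f (xs ! i))" "p dvd (\<Sum>i\<in>?T. g (xs ! i))"
    by (simp_all flip: of_nat_sum)
  have "?T \<subseteq> {..<length xs}" using len by auto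
  then obtain ys where ys: "mset ys \<subseteq># mset xs" "length ys = card ?T"
    "\<And>f :: 'a \<Rightarrow> nat. sum_list (map f ys) = (\<Sum>i\<in>?T. f (xs ! i))"
    by (rule sublist_of_index_set) metis
  \<comment> \<open>The padding has only \<open>p - 1\<close> indices and cannot contain all of
    \<open>T\<close>.\<close>
  have "?T \<noteq> {}"
  proof
    assume "?T = {}"
    then have "i \<in> {?N..<4 * p - 3}" if "i \<in> T" for i
      using that T(1) by (metis IntI atLeastLessThan_iff empty_iff lessThan_iff not_less subsetD)
    then have "T \<subseteq> {?N..<4 * p - 3}" by blast
    then have "card T \<le> p - 1" using card_mono[of "{?N..<4 * p - 3}" T] by simp
    then show False using T(2) p2 by simp
  qed
  then have "ys \<noteq> []" using ys(2) fin by auto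
  moreover have "length ys \<le> p" using ys(2) T(2) fin card_mono[of T ?T] by simp
  ultimately show thesis using dvd ys by (intro that[of ys]) simp_all
qed

text \<open>Greedy extraction: before the last of \<open>k\<close> blocks is taken, at most
  \<open>p * (k - 1)\<close> terms are gone, so \<open>N\<close> terms must still remain at that
  point.\<close>

lemma extract_blocks:
  fixes C :: "'a set"
  assumes block: "\<And>xs. set xs \<subseteq> C \<Longrightarrow> N \<le> length xs \<Longrightarrow>
      \<exists>ys. mset ys \<subseteq># mset xs \<and> length ys \<le> p \<and> Q ys"
    and "set xs \<subseteq> C" "N + p * k \<le> length xs + p"
  obtains Bs where "length Bs = k" "mset (concat Bs) \<subseteq># mset xs" "\<And>B. B \<in> set Bs \<Longrightarrow> length B \<le> p \<and> Q B"
proof -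
  have "\<exists>Bs. length Bs = k \<and> mset (concat Bs) \<subseteq># mset xs \<and> (\<forall>B\<in>set Bs. length B \<le> p \<and> Q B)"
    using assms(2,3)
  proof (induction k arbitrary: xs)
    case (Suc k)
    then obtain ys where ys: "mset ys \<subseteq># mset xs" "length ys \<le> p" "Q ys"
      using block[of xs] by auto
    obtain zs where zs: "mset zs = mset xs - mset ys" using ex_mset by blast
    have xs: "mset xs = mset ys + mset zs" using ys(1) zs by simp
    then have "set zs \<subseteq> C" using Suc.prems(1) by (metis le_sup_iff set_mset_mset set_mset_union)
    moreover have "length xs = length ys + length zs" using xs by (metis size_mset size_union)
    ultimately obtain Bs where Bs: "length Bs = k" "mset (concat Bs) \<subseteq># mset zs"
      "\<forall>B\<in>set Bs. length B \<le> p \<and> Q B"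
      using Suc.IH[of zs] Suc.prems(2) ys(2) by auto
    then show ?case
      using xs ys by (intro exI[of _ "ys # Bs"]) auto
  qed simp
  then show thesis using that by blast
qed

lemma mset_subset_map:
  assumes "mset ys \<subseteq># mset (map f xs)"
  obtains zs where "mset zs \<subseteq># mset xs" "map f zs = ys"
proof -
  have "\<exists>zs. mset zs \<subseteq># mset xs \<and> map f zs = ys"
    using assms
  proof (induction ys arbitrary: xs)
    case (Cons y ys)
    then have "y \<in># mset (map f xs)" by (auto dest: mset_subset_eqD)
    then obtain x where x: "x \<in> set xs" "y = f x" by auto
    then obtain us vs where xs: "xs = us @ x # vs" using split_list by metis
    have "mset ys \<subseteq># mset (map f (us @ vs))"
      using Cons.prems x(2) by (simp add: xs)
    then obtain zs where "mset zs \<subseteq># mset (us @ vs)" "map f zs = ys" using Cons.IH by blast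
    then show ?case using x xs by (intro exI[of _ "x # zs"]) auto
  qed simp
  then show thesis using that by blast
qed

lemma mset_concat_mono:
  assumes "mset Bs' \<subseteq># mset Bs"
  shows "mset (concat Bs') \<subseteq># mset (concat Bs)"
proof -
  obtain D where "mset Bs = mset Bs' + D" using assms mset_subset_eq_exists_conv by blast
  then show ?thesis by (simp add: mset_concat flip: sum_mset_sum_list)
qed

definition div_block :: "nat \<Rightarrow> (nat \<times> nat) list \<Rightarrow> nat \<times> nat" where
  "div_block q B = (sum_list (map fst B) div q, sum_list (map snd B) div q)"

lemma sum_concat_div_block:
  assumes "\<And>B. B \<in> set Bs \<Longrightarrow> q dvd sum_list (map fst B) \<and> q dvd sum_list (map snd B)"
  shows "sum_list (map fst (concat Bs)) = q * sum_list (map fst (map (div_block q) Bs))"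
    "sum_list (map snd (concat Bs)) = q * sum_list (map snd (map (div_block q) Bs))"
  using assms by (induction Bs) (auto simp: div_block_def distrib_left)

lemma sum_list_eq_length:
  assumes "\<And>e. e \<in> set xs \<Longrightarrow> f e = (1::nat)"
  shows "sum_list (map f xs) = length xs"
  using assms by (induction xs) auto

lemma length_concat_const:
  assumes "\<And>B. B \<in> set Bs \<Longrightarrow> length B = p"
  shows "length (concat Bs) = p * length Bs"
  using assms by (induction Bs) auto

lemma split_sublist:
  assumes "mset ys \<subseteq># mset xs"
  obtains zs where "mset xs = mset ys + mset zs" "length xs = length ys + length zs"
    "set ys \<subseteq> set xs" "set zs \<subseteq> set xs"
proof -
  obtain zs where zs: "mset zs = mset xs - mset ys" using ex_mset by blast
  then have e: "mset xs = mset ys + mset zs" using assms by simp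
  show thesis
  proof (rule that[OF e])
    show "length xs = length ys + length zs" using e by (metis size_mset size_union)
    show "set ys \<subseteq> set xs" "set zs \<subseteq> set xs"
      using e by (metis set_mset_mset set_mset_union sup_ge1, metis set_mset_mset set_mset_union sup_ge2)
  qed
qed

text \<open>The second component is a weight. Allowing one term of arbitrary weight makes the claim
  inductive: the terms left over after the extraction of blocks of length \<open>q\<close> contain one more
  block, whose length is not under control.\<close>

lemma cyclic_weighted:
  assumes "0 < n" "\<And>e. e \<in> set xs \<Longrightarrow> snd e = 1" "length xs + 2 = 2 * n"
  shows "\<exists>ys. mset ys \<subseteq># mset (z # xs) \<and> ys \<noteq> [] \<and> n dvd sum_list (map fst ys) \<and> n dvd sum_list (map snd ys)"
  using assms
proof (induction n arbitrary: xs z rule: less_induct)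
  case (less n)
  show ?case
  proof (cases "n = 1")
    case True
    then show ?thesis by (intro exI[of _ "[z]"]) auto
  next
    case False
    then obtain q where q: "prime q" "q dvd n" using prime_factor_nat by blast
    then obtain n' where n: "n = q * n'" by blast
    have q2: "q \<ge> 2" using q(1) prime_ge_2_nat by blast
    have n': "0 < n'" "n' < n" using n less.prems(1) q2 by auto
    \<comment> \<open>The induction hypothesis for \<open>n'\<close> wants \<open>r\<close> terms of
      weight 1 besides the distinguished one.\<close>
    obtain r where r: "2 * n' = r + 2" using n'(1) by (metis Suc_leI add.commute le_Suc_ex mult_2 mult_le_mono2 nat_mult_1_right one_add_one Suc_eq_plus1 add_0)
    have "q * (2 * n') = q * (r + 2)" using r by simp
    then have len: "length xs + 2 = q * r + 2 * q" using less.prems(3) n by (simp add: algebra_simps)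
    let ?Q = "\<lambda>B. length B = q \<and> q dvd sum_list (map fst B)"
    obtain Bs where Bs: "length Bs = r" "mset (concat Bs) \<subseteq># mset xs"
      "\<And>B. B \<in> set Bs \<Longrightarrow> length B \<le> q \<and> ?Q B"
    proof (rule extract_blocks[of "set xs" "2 * q - 1" q ?Q xs r])
      fix ys :: "(nat \<times> nat) list"
      assume "2 * q - 1 \<le> length ys"
      then obtain B where "mset B \<subseteq># mset ys" "length B = q" "q dvd sum_list (map fst B)"
        using Erdos_Ginzburg_Ziv_prime[OF q(1)] by metis
      then show "\<exists>B. mset B \<subseteq># mset ys \<and> length B \<le> q \<and> ?Q B" by auto
    qed (use len q2 in auto)
    obtain zs where zs: "mset xs = mset (concat Bs) + mset zs"
      "length xs = length (concat Bs) + length zs" "set (concat Bs) \<subseteq> set xs"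
      using split_sublist[OF Bs(2)] by metis
    have "length (concat Bs) = q * r" using length_concat_const[of Bs q] Bs by auto
    then have "2 * (q - 1) < length (z # zs)" using len zs(2) by simp
    \<comment> \<open>With \<open>z\<close>, exactly \<open>2 * q - 1\<close> terms remain, enough
      for the two conditions on value and weight. The rescaled \<open>B0\<close> becomes the new
      distinguished term.\<close>
    then obtain B0 where B0: "mset B0 \<subseteq># mset (z # zs)" "B0 \<noteq> []"
      "q dvd sum_list (map fst B0)" "q dvd sum_list (map snd B0)"
      using zero_sum_sublist[OF q(1), of "[fst, snd]" "z # zs"] by auto
    have wt: "sum_list (map snd B) = q" if "B \<in> set Bs" for B
      using sum_list_eq_length[of B snd] zs(3) less.prems(2) Bs(3)[OF that] that by fastforce
    let ?Bs = "B0 # Bs"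
    have dvd: "q dvd sum_list (map fst B) \<and> q dvd sum_list (map snd B)" if "B \<in> set ?Bs" for B
      using that B0 Bs(3) wt by auto
    have "snd e = 1" if "e \<in> set (map (div_block q) Bs)" for e
      using that wt q2 by (auto simp: div_block_def)
    then obtain ys where ys: "mset ys \<subseteq># mset (div_block q B0 # map (div_block q) Bs)" "ys \<noteq> []"
      "n' dvd sum_list (map fst ys)" "n' dvd sum_list (map snd ys)"
      using less.IH[OF n'(2,1), of "map (div_block q) Bs" "div_block q B0"] Bs(1) r by auto
    then have "mset ys \<subseteq># mset (map (div_block q) ?Bs)" by simp
    then obtain Bs' where Bs': "mset Bs' \<subseteq># mset ?Bs" "map (div_block q) Bs' = ys"
      by (rule mset_subset_map)
    have sub: "set Bs' \<subseteq> set ?Bs" using Bs'(1) by (metis set_mset_mono set_mset_mset)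
    have "mset (concat ?Bs) \<subseteq># mset (z # xs)" using zs(1) B0(1) by simp
    then have "mset (concat Bs') \<subseteq># mset (z # xs)"
      using mset_concat_mono[OF Bs'(1)] subset_mset.trans by blast
    moreover have "concat Bs' \<noteq> []"
    proof -
      obtain B where "B \<in> set Bs'" using ys(2) Bs'(2) by (cases Bs') auto
      moreover from this have "B \<noteq> []" using sub B0(2) Bs(3) q2 by fastforce
      ultimately show ?thesis by auto
    qed
    moreover have "sum_list (map fst (concat Bs')) = q * sum_list (map fst ys)"
      "sum_list (map snd (concat Bs')) = q * sum_list (map snd ys)"
      unfolding Bs'(2)[symmetric] using dvd sub by (intro sum_concat_div_block; blast)+
    then have "n dvd sum_list (map fst (concat Bs'))" "n dvd sum_list (map snd (concat Bs'))"
      using ys(3,4) n by simp_all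
    ultimately show ?thesis by blast
  qed
qed

text \<open>Two of the \<open>n + 1\<close> prefix sums agree modulo \<open>n\<close>; the segment
  between them is the sublist.\<close>

lemma cyclic_zero_sum:
  fixes f :: "'a \<Rightarrow> nat"
  assumes "n \<le> length xs" "0 < n"
  obtains ys where "mset ys \<subseteq># mset xs" "ys \<noteq> []" "length ys \<le> n" "n dvd sum_list (map f ys)"
proof -
  let ?S = "\<lambda>k. sum_list (map f (take k xs)) mod n"
  have "card (?S ` {..n}) \<le> card {..<n}" using assms(2) by (intro card_mono) auto
  then have "card (?S ` {..n}) < card {..n}" by simp
  then have "\<not> inj_on ?S {..n}" by (rule pigeonhole)
  then obtain i j where ij: "i < j" "j \<le> n" "?S i = ?S j"
    unfolding inj_on_def by (metis atMost_iff linorder_neqE_nat)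
  let ?ys = "drop i (take j xs)"
  have take: "take j xs = take i xs @ ?ys"
    using ij(1) by (metis append_take_drop_id min.absorb3 min.commute take_take)
  have "mset xs = mset (take j xs) + mset (drop j xs)" by (metis append_take_drop_id mset_append)
  also have "mset (take j xs) = mset (take i xs) + mset ?ys" using take by (metis mset_append)
  finally have "mset ?ys \<subseteq># mset xs" by simp
  moreover have "?ys \<noteq> []" "length ?ys \<le> n" using ij assms(1) by auto
  moreover have "n dvd sum_list (map f ?ys)"
  proof -
    have "[sum_list (map f (take i xs)) + sum_list (map f ?ys) = sum_list (map f (take i xs)) + 0] (mod n)"
      using ij(3) take unfolding cong_def by (metis add.right_neutral map_append sum_list.append)
    then show ?thesis unfolding cong_add_lcancel_nat by (simp add: cong_0_iff)
  qed
  ultimately show thesis using that by blast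
qed

section \<open>Exponents of products in a semidirect product\<close>

abbreviation yexp :: "nat \<times> nat \<times> nat \<Rightarrow> nat" where "yexp e \<equiv> fst (snd e)"
abbreviation weight :: "nat \<times> nat \<times> nat \<Rightarrow> nat" where "weight e \<equiv> snd (snd e)"

text \<open>In a group with \<open>y * x = x ^ s * y\<close>, the product of the terms \<open>x ^ i * y ^ j\<close>, over the
  triples \<open>(i, j, w)\<close> of a list, has the exponent \<open>xexp s\<close> at \<open>x\<close>, whereas the exponents at \<open>y\<close> add.
  The weight \<open>w\<close> counts how many terms of the original sequence a triple stands for.\<close>

fun xexp :: "nat \<Rightarrow> (nat \<times> nat \<times> nat) list \<Rightarrow> nat" where
  "xexp s [] = 0"
| "xexp s (e # es) = fst e + s ^ yexp e * xexp s es"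

lemma xexp_append: "xexp s (xs @ ys) = xexp s xs + s ^ sum_list (map yexp xs) * xexp s ys"
  by (induction xs) (auto simp: algebra_simps power_add)

text \<open>The arithmetic form of commutativity modulo \<open>H\<close>: the twists
  \<open>s ^ j\<close> become 1, so blocks can be found by zero-sum theorems that ignore the
  order.\<close>

lemma xexp_cong:
  assumes "[s = 1] (mod d)"
  shows "[xexp s xs = sum_list (map fst xs)] (mod d)"
proof (induction xs)
  case (Cons e xs)
  have "[s ^ yexp e * xexp s xs = 1 ^ yexp e * sum_list (map fst xs)] (mod d)"
    using assms Cons by (intro cong_mult cong_pow)
  then show ?case by (simp add: cong_add_lcancel_nat)
qed simp

lemma dvd_xexp_iff:
  assumes "[s = 1] (mod d)"
  shows "d dvd xexp s xs \<longleftrightarrow> d dvd sum_list (map fst xs)"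
  using xexp_cong[OF assms, of xs] cong_dvd_iff by blast

text \<open>The pairs with both exponents divisible by \<open>p\<close> form a copy of the structure in which
  \<open>s\<close> is replaced by \<open>s ^ p\<close>; \<open>contract p s\<close> sends a block with product in it to its product.\<close>

definition contract :: "nat \<Rightarrow> nat \<Rightarrow> (nat \<times> nat \<times> nat) list \<Rightarrow> nat \<times> nat \<times> nat" where
  "contract p s B = (xexp s B div p, sum_list (map yexp B) div p, sum_list (map weight B) div p)"

text \<open>Divisibility of the weight is kept out, because the blocks in
  \<open>semidirect_short\<close> have no prescribed length.\<close>

definition kernel_block :: "nat \<Rightarrow> nat \<Rightarrow> (nat \<times> nat \<times> nat) list \<Rightarrow> bool" where
  "kernel_block p s B \<longleftrightarrow> p dvd xexp s B \<and> p dvd sum_list (map yexp B)"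

text \<open>A block with exponent \<open>p * j\<close> at \<open>y\<close> twists what follows by
  \<open>s ^ (p * j) = (s ^ p) ^ j\<close>, so a concatenation of blocks evaluates like the list of
  contracted blocks with twist \<open>s ^ p\<close>, scaled by \<open>p\<close>.\<close>

lemma exponents_concat:
  assumes "\<And>B. B \<in> set Bs \<Longrightarrow> kernel_block p s B"
  shows "sum_list (map yexp (concat Bs)) = p * sum_list (map yexp (map (contract p s) Bs))"
    and "xexp s (concat Bs) = p * xexp (s ^ p) (map (contract p s) Bs)"
proof -
  show "sum_list (map yexp (concat Bs)) = p * sum_list (map yexp (map (contract p s) Bs))"
    using assms by (induction Bs) (auto simp: contract_def kernel_block_def distrib_left)
  show "xexp s (concat Bs) = p * xexp (s ^ p) (map (contract p s) Bs)"
    using assms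
  proof (induction Bs)
    case (Cons B Bs)
    then obtain i j where "xexp s B = p * i" "sum_list (map yexp B) = p * j"
      by (force simp: kernel_block_def)
    then show ?case using Cons
      by (cases "p = 0") (auto simp: xexp_append contract_def power_mult distrib_left)
  qed simp
qed

lemma weight_concat:
  assumes "\<And>B. B \<in> set Bs \<Longrightarrow> p dvd sum_list (map weight B)"
  shows "sum_list (map weight (concat Bs)) = p * sum_list (map weight (map (contract p s) Bs))"
  using assms by (induction Bs) (auto simp: contract_def distrib_left)

text \<open>The blocks are arranged in the order of the solution \<open>ys\<close>, each keeping its
  inner order; this matters because the product does not commute.\<close>

lemma lift_blocks:
  assumes "mset (concat Bs) \<subseteq># mset xs" "\<And>B. B \<in> set Bs \<Longrightarrow> kernel_block p s B"
    and "mset ys \<subseteq># mset (map (contract p s) Bs)"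
    and "m * n dvd xexp (s ^ p) ys" "m dvd sum_list (map yexp ys)"
  obtains Bs' where "set Bs' \<subseteq> set Bs" "map (contract p s) Bs' = ys" "mset (concat Bs') \<subseteq># mset xs"
    "p * m * n dvd xexp s (concat Bs')" "p * m dvd sum_list (map yexp (concat Bs'))"
proof -
  obtain Bs' where Bs': "mset Bs' \<subseteq># mset Bs" "map (contract p s) Bs' = ys"
    using mset_subset_map[OF assms(3)] by metis
  show thesis
  proof (rule that[OF _ Bs'(2)])
    show sub: "set Bs' \<subseteq> set Bs" using Bs'(1) by (metis set_mset_mono set_mset_mset)
    show "mset (concat Bs') \<subseteq># mset xs"
      using mset_concat_mono[OF Bs'(1)] assms(1) subset_mset.trans by blast
    have ker: "kernel_block p s B" if "B \<in> set Bs'" for B using that sub assms(2) by blast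
    have "xexp s (concat Bs') = p * xexp (s ^ p) ys"
      "sum_list (map yexp (concat Bs')) = p * sum_list (map yexp ys)"
      unfolding Bs'(2)[symmetric] by (intro exponents_concat ker; assumption)+
    then show "p * m * n dvd xexp s (concat Bs')" "p * m dvd sum_list (map yexp (concat Bs'))"
      using assms(4,5) by (simp_all add: mult.assoc)
  qed
qed

text \<open>For the smallest prime divisor \<open>p\<close> of \<open>m\<close>, no nontrivial element of the unit group of order
  \<open>p - 1\<close> has an order dividing \<open>m\<close>.\<close>

lemma trivial_action_prime:
  fixes m n s :: nat
  assumes "1 < m" "[s ^ m = 1] (mod m * n)"
  obtains p m' where "prime p" "m = p * m'" "0 < m'" "m' < m" "[s = 1] (mod p)" "[(s ^ p) ^ m' = 1] (mod m' * n)"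
proof -
  define p where "p = (LEAST q. prime q \<and> q dvd m)"
  have "\<exists>q. prime q \<and> q dvd m" using assms(1) prime_factor_nat[of m] by auto
  then have p: "prime p" "p dvd m" unfolding p_def by (metis (mono_tags, lifting) LeastI_ex)+
  have least: "p \<le> q" if "prime q" "q dvd m" for q
    unfolding p_def using that by (intro Least_le) simp
  have p2: "p \<ge> 2" using p(1) prime_ge_2_nat by blast
  obtain m' where m: "m = p * m'" using p(2) by blast
  have "m' \<noteq> 0" using m assms(1) by (intro notI) simp
  then have m': "0 < m'" "m' < m" using m p2 by auto
  have 1: "[s ^ m = 1] (mod p)" using assms(2) p(2) cong_dvd_modulus_nat dvd_mult2 by blast
  \<comment> \<open>A common prime divisor would divide \<open>m\<close> and be smaller than
    \<open>p\<close>.\<close>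
  have "coprime m (p - 1)"
  proof (rule ccontr)
    assume "\<not> coprime m (p - 1)"
    then have "gcd m (p - 1) \<noteq> 1" by (simp add: coprime_iff_gcd_eq_1)
    then obtain q where q: "prime q" "q dvd gcd m (p - 1)" using prime_factor_nat by blast
    then have "p \<le> q" using least by simp
    moreover have "q \<le> p - 1" using q p2 by (intro dvd_imp_le) auto
    ultimately show False using p2 by simp
  qed
  \<comment> \<open>With these exponents \<open>s\<close> is congruent to
    \<open>s * (s ^ (p - 1)) ^ v = (s ^ m) ^ u\<close>, hence to 1.\<close>
  then obtain u v where uv: "m * u = (p - 1) * v + 1"
    using bezout_nat[of m "p - 1"] assms(1) by auto
  have "\<not> p dvd s"
  proof
    assume "p dvd s"
    then have "p dvd s ^ m" using assms(1) dvd_trans[OF _ dvd_power[of m s]] by simp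
    then show False using 1 p(1) cong_dvd_iff not_prime_unit by blast
  qed
  then have 2: "[s ^ (p - 1) = 1] (mod p)" using p(1) fermat_theorem by blast
  have "[s ^ (m * u) = 1] (mod p)" using cong_pow[OF 1, of u] by (simp add: power_mult)
  moreover have "[s ^ ((p - 1) * v + 1) = 1 * s] (mod p)"
    using cong_mult[OF cong_pow[OF 2, of v] cong_refl[of s]]
    by (simp only: power_add power_mult power_one_right power_one)
  ultimately have "[s = 1] (mod p)" unfolding uv using cong_sym cong_trans by (metis mult_1)
  moreover have "[(s ^ p) ^ m' = 1] (mod m' * n)"
    using assms(2) m by (metis cong_modulus_mult_nat mult.assoc mult.commute power_mult)
  ultimately show thesis using that p(1) m m' by blast
qed

section \<open>The three inductions on \<open>m\<close>\<close>

lemma blocks_exact: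
  assumes "prime p" "[s = 1] (mod p)" "length xs + 3 \<ge> p * (r + 3)"
  obtains Bs where "length Bs = r" "mset (concat Bs) \<subseteq># mset xs"
    "\<And>B. B \<in> set Bs \<Longrightarrow> length B = p \<and> kernel_block p s B"
proof -
  have p2: "p \<ge> 2" using assms(1) prime_ge_2_nat by blast
  show thesis
  proof (rule extract_blocks[of "set xs" "4 * p - 3" p "\<lambda>B. length B = p \<and> kernel_block p s B" xs r])
    fix ys :: "(nat \<times> nat \<times> nat) list"
    assume "4 * p - 3 \<le> length ys"
    then obtain B where "mset B \<subseteq># mset ys" "length B = p"
      "p dvd sum_list (map fst B)" "p dvd sum_list (map yexp B)"
      using Reiher_list[OF assms(1)] by metis
    then show "\<exists>B. mset B \<subseteq># mset ys \<and> length B \<le> p \<and> length B = p \<and> kernel_block p s B"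
      using dvd_xexp_iff[OF assms(2), of B] by (auto simp: kernel_block_def)
  next
    \<comment> \<open>Each further block costs \<open>p\<close> terms and the first needs
      \<open>4 * p - 3\<close>, whence the scaling form
      \<open>length xs + 3 >= p * (r + 3)\<close>.\<close>
    show "4 * p - 3 + p * r \<le> length xs + p" using assms(3) p2 by (simp add: algebra_simps)
  qed (use that in auto)
qed

text \<open>The device of \<open>cyclic_weighted\<close> with one more coordinate. Once all weights
  are 1, the last conclusion says that the length is a multiple of \<open>m * n\<close>.\<close>

lemma semidirect_weighted:
  assumes "0 < m" "0 < n" "[s ^ m = 1] (mod m * n)"
    "\<And>e. e \<in> set xs \<Longrightarrow> weight e = 1" "length xs + 3 = m + 2 * m * n"
  shows "\<exists>ys. mset ys \<subseteq># mset (z # xs) \<and> ys \<noteq> [] \<and> m * n dvd xexp s ys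
    \<and> m dvd sum_list (map yexp ys) \<and> m * n dvd sum_list (map weight ys)"
  using assms
proof (induction m arbitrary: s xs z rule: less_induct)
  case (less m)
  show ?case
  proof (cases "m = 1")
    case True
    let ?h = "\<lambda>e. (fst e, weight e)"
    have "snd e = 1" if e: "e \<in> set (map ?h xs)" for e
    proof -
      obtain x where "x \<in> set xs" "e = ?h x" using e by auto
      then show ?thesis using less.prems(4) by simp
    qed
    moreover have "length (map ?h xs) + 2 = 2 * n" using less.prems(5) True by simp
    ultimately obtain ys where ys: "mset ys \<subseteq># mset (?h z # map ?h xs)" "ys \<noteq> []"
      "n dvd sum_list (map fst ys)" "n dvd sum_list (map snd ys)"
      using cyclic_weighted[OF less.prems(2), of "map ?h xs" "?h z"] by blast
    then have "mset ys \<subseteq># mset (map ?h (z # xs))" by simp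
    then obtain zs where zs: "mset zs \<subseteq># mset (z # xs)" "map ?h zs = ys"
      by (rule mset_subset_map)
    have "[s = 1] (mod n)" using less.prems(3) True by simp
    then have "n dvd xexp s zs"
      using ys(3) zs(2) by (auto simp: dvd_xexp_iff comp_def)
    moreover have "n dvd sum_list (map weight zs)" using ys(4) zs(2) by (auto simp: comp_def)
    ultimately show ?thesis using zs ys(2) True by (intro exI[of _ zs]) auto
  next
    case False
    then have "1 < m" using less.prems(1) by simp
    from trivial_action_prime[OF this less.prems(3)] obtain p m' where
      p: "prime p" "[s = 1] (mod p)" and m: "m = p * m'" and m': "0 < m'" "m' < m"
      and act: "[(s ^ p) ^ m' = 1] (mod m' * n)" by metis
    have p2: "p \<ge> 2" using p(1) prime_ge_2_nat by blast
    have "m' * n \<ge> 1" using m' less.prems(2) by simp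
    then have "3 \<le> m' + 2 * (m' * n)" using m' by linarith
    then obtain r where r: "m' + 2 * m' * n = r + 3" by (metis add.commute le_Suc_ex mult.assoc)
    have "m + 2 * m * n = p * (m' + 2 * m' * n)" using m by (simp add: algebra_simps)
    then have len: "length xs + 3 = p * (r + 3)" using less.prems(5) r by simp
    then obtain Bs where Bs: "length Bs = r" "mset (concat Bs) \<subseteq># mset xs"
      "\<And>B. B \<in> set Bs \<Longrightarrow> length B = p \<and> kernel_block p s B"
      using blocks_exact[OF p] by (metis order_refl)
    obtain zs where zs: "mset xs = mset (concat Bs) + mset zs"
      "length xs = length (concat Bs) + length zs" "set (concat Bs) \<subseteq> set xs"
      using split_sublist[OF Bs(2)] by metis
    have "length (concat Bs) = p * r" using length_concat_const[of Bs p] Bs by auto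
    \<comment> \<open>Exactly \<open>3 * p - 2\<close> terms remain with \<open>z\<close>, enough
      for conditions on both exponents and on the weight.\<close>
    then have "3 * (p - 1) < length (z # zs)" using len zs(2) by (simp add: algebra_simps)
    then obtain B0 where B0: "mset B0 \<subseteq># mset (z # zs)" "B0 \<noteq> []"
      "p dvd sum_list (map fst B0)" "p dvd sum_list (map yexp B0)" "p dvd sum_list (map weight B0)"
      using zero_sum_sublist[OF p(1), of "[fst, yexp, weight]" "z # zs"] by auto
    let ?Bs = "B0 # Bs"
    have wt: "sum_list (map weight B) = p" if "B \<in> set Bs" for B
      using sum_list_eq_length[of B weight] zs(3) less.prems(4) Bs(3)[OF that] that by fastforce
    have ker: "kernel_block p s B" if "B \<in> set ?Bs" for B
      using that B0 Bs(3) p(2) by (auto simp: kernel_block_def dvd_xexp_iff)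
    have "weight e = 1" if "e \<in> set (map (contract p s) Bs)" for e
      using that wt p2 by (auto simp: contract_def)
    \<comment> \<open>The contracted \<open>B0\<close>, whose weight need not be 1, takes the place
      of \<open>z\<close>.\<close>
    then obtain ys where ys: "mset ys \<subseteq># mset (contract p s B0 # map (contract p s) Bs)" "ys \<noteq> []"
      "m' * n dvd xexp (s ^ p) ys" "m' dvd sum_list (map yexp ys)" "m' * n dvd sum_list (map weight ys)"
      using less.IH[OF m'(2,1) less.prems(2) act, of "map (contract p s) Bs" "contract p s B0"] Bs(1) r
      by auto
    then have "mset ys \<subseteq># mset (map (contract p s) ?Bs)" by simp
    moreover have "mset (concat ?Bs) \<subseteq># mset (z # xs)" using zs(1) B0(1) by simp
    ultimately obtain Bs' where Bs': "set Bs' \<subseteq> set ?Bs" "map (contract p s) Bs' = ys"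
      "mset (concat Bs') \<subseteq># mset (z # xs)"
      "p * m' * n dvd xexp s (concat Bs')" "p * m' dvd sum_list (map yexp (concat Bs'))"
      using lift_blocks[of ?Bs "z # xs" p s ys m' n] ker ys(3,4) by metis
    have "concat Bs' \<noteq> []"
    proof -
      obtain B where "B \<in> set Bs'" using ys(2) Bs'(2) by (cases Bs') auto
      moreover from this have "B \<noteq> []" using Bs'(1) B0(2) Bs(3) p2 by fastforce
      ultimately show ?thesis by auto
    qed
    moreover have "p dvd sum_list (map weight B)" if "B \<in> set Bs'" for B
      using that Bs'(1) B0(5) wt by auto
    then have "p * (m' * n) dvd sum_list (map weight (concat Bs'))"
      using weight_concat[of Bs' p s] Bs'(2) ys(5) by auto
    ultimately show ?thesis using Bs' m by (intro exI[of _ "concat Bs'"]) (simp add: mult.assoc)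
  qed
qed

text \<open>Lengths multiply: at most \<open>m' * n\<close> blocks of at most \<open>p\<close> terms
  have at most \<open>m * n\<close> terms together. No leftover block is required here.\<close>

lemma semidirect_short:
  assumes "0 < m" "0 < n" "[s ^ m = 1] (mod m * n)" "2 * m + m * n \<le> length xs + 2"
  shows "\<exists>ys. mset ys \<subseteq># mset xs \<and> ys \<noteq> [] \<and> length ys \<le> m * n \<and> m * n dvd xexp s ys
    \<and> m dvd sum_list (map yexp ys)"
  using assms
proof (induction m arbitrary: s xs rule: less_induct)
  case (less m)
  show ?case
  proof (cases "m = 1")
    case True
    obtain ys where ys: "mset ys \<subseteq># mset xs" "ys \<noteq> []" "length ys \<le> n" "n dvd sum_list (map fst ys)"
      using cyclic_zero_sum[of n xs fst] less.prems True by auto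
    moreover have "[s = 1] (mod n)" using less.prems(3) True by simp
    ultimately show ?thesis using True by (intro exI[of _ ys]) (simp add: dvd_xexp_iff)
  next
    case False
    then have "1 < m" using less.prems(1) by simp
    from trivial_action_prime[OF this less.prems(3)] obtain p m' where
      p: "prime p" "[s = 1] (mod p)" and m: "m = p * m'" and m': "0 < m'" "m' < m"
      and act: "[(s ^ p) ^ m' = 1] (mod m' * n)" by metis
    have p2: "p \<ge> 2" using p(1) prime_ge_2_nat by blast
    have "2 \<le> 2 * m' + m' * n" using m' by linarith
    then obtain r where r: "2 * m' + m' * n = r + 2" by (metis add.commute le_Suc_ex)
    have "2 * m + m * n = p * (2 * m' + m' * n)" using m by (simp add: algebra_simps)
    also have "\<dots> = p * r + 2 * p" unfolding r by simp
    finally have len: "p * r + 2 * p \<le> length xs + 2" using less.prems(4) by simp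
    let ?Q = "\<lambda>B. B \<noteq> [] \<and> kernel_block p s B"
    obtain Bs where Bs: "length Bs = r" "mset (concat Bs) \<subseteq># mset xs"
      "\<And>B. B \<in> set Bs \<Longrightarrow> length B \<le> p \<and> ?Q B"
    proof (rule extract_blocks[of "set xs" "3 * p - 2" p ?Q xs r])
      fix ys :: "(nat \<times> nat \<times> nat) list"
      assume "3 * p - 2 \<le> length ys"
      then obtain B where "mset B \<subseteq># mset ys" "B \<noteq> []" "length B \<le> p"
        "p dvd sum_list (map fst B)" "p dvd sum_list (map yexp B)"
        using short_zero_sum_sublist[OF p(1)] by metis
      then show "\<exists>B. mset B \<subseteq># mset ys \<and> length B \<le> p \<and> ?Q B"
        using dvd_xexp_iff[OF p(2), of B] by (auto simp: kernel_block_def)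
    qed (use len p2 in auto)
    obtain ys where ys: "mset ys \<subseteq># mset (map (contract p s) Bs)" "ys \<noteq> []" "length ys \<le> m' * n"
      "m' * n dvd xexp (s ^ p) ys" "m' dvd sum_list (map yexp ys)"
      using less.IH[OF m'(2,1) less.prems(2) act, of "map (contract p s) Bs"] Bs(1) r by auto
    then obtain Bs' where Bs': "set Bs' \<subseteq> set Bs" "map (contract p s) Bs' = ys"
      "mset (concat Bs') \<subseteq># mset xs"
      "p * m' * n dvd xexp s (concat Bs')" "p * m' dvd sum_list (map yexp (concat Bs'))"
      using lift_blocks[of Bs xs p s ys m' n] Bs by metis
    have "concat Bs' \<noteq> []"
    proof -
      obtain B where "B \<in> set Bs'" using ys(2) Bs'(2) by (cases Bs') auto
      then show ?thesis using Bs'(1) Bs(3) by fastforce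
    qed
    moreover have "length (concat Bs') \<le> p * length Bs'"
      using Bs'(1) Bs(3) by (induction Bs') (auto simp: add_mono)
    then have "length (concat Bs') \<le> p * (m' * n)"
      using ys(3) Bs'(2) by (metis length_map mult_le_mono2 order_trans)
    ultimately show ?thesis using Bs' m by (intro exI[of _ "concat Bs'"]) (simp add: mult.assoc)
  qed
qed

text \<open>Blocks of length exactly \<open>p\<close> turn a solution of length
  \<open>m' * n\<close> into one of length \<open>m * n\<close>, so the length need not be tracked
  by weights.\<close>

lemma semidirect_exact:
  assumes "0 < m" "0 < n" "[s ^ m = 1] (mod m * n)" "2 * m + 2 * m * n \<le> length xs + 3"
  shows "\<exists>ys. mset ys \<subseteq># mset xs \<and> length ys = m * n \<and> m * n dvd xexp s ys
    \<and> m dvd sum_list (map yexp ys)"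
  using assms
proof (induction m arbitrary: s xs rule: less_induct)
  case (less m)
  show ?case
  proof (cases "m = 1")
    case True
    \<comment> \<open>With every weight equal to 1, \<open>cyclic_weighted\<close> is the
      Erdos-Ginzburg-Ziv theorem: a nonempty solution has length divisible by \<open>n\<close> and
      below \<open>2 * n\<close>.\<close>
    let ?xs = "take (2 * n - 1) xs"
    let ?h = "\<lambda>e. (fst e, 1::nat)"
    have len: "length ?xs = 2 * n - 1" using less.prems True by simp
    then obtain z zs where z: "?xs = z # zs" using less.prems(2) by (cases ?xs) auto
    have "length (z # zs) = 2 * n - 1" using len unfolding z .
    then have "length (map ?h zs) + 2 = 2 * n" using less.prems(2) by simp
    moreover have "snd e = 1" if "e \<in> set (map ?h zs)" for e using that by auto
    ultimately obtain ys where ys: "mset ys \<subseteq># mset (?h z # map ?h zs)" "ys \<noteq> []"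
      "n dvd sum_list (map fst ys)" "n dvd sum_list (map snd ys)"
      using cyclic_weighted[OF less.prems(2), of "map ?h zs" "?h z"] by blast
    then have "mset ys \<subseteq># mset (map ?h ?xs)" using z by simp
    then obtain ws where ws: "mset ws \<subseteq># mset ?xs" "map ?h ws = ys"
      by (rule mset_subset_map)
    have "[s = 1] (mod n)" using less.prems(3) True by simp
    then have "n dvd xexp s ws" using ys(3) ws(2) by (auto simp: dvd_xexp_iff comp_def)
    moreover have "length ws = n"
    proof -
      have "n dvd length ws" using ys(4) ws(2) by (auto simp: comp_def sum_list_triv)
      then obtain r where r: "length ws = n * r" by blast
      have "length ws \<le> 2 * n - 1" using size_mset_mono[OF ws(1)] len by simp
      then have "n * r < n * 2" using r less.prems(2) by linarith
      then have "r < 2" by (metis mult_less_cancel1)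
      moreover have "r \<noteq> 0" using r ys(2) ws(2) by (cases r) auto
      ultimately show ?thesis using r by (cases "r = 1") auto
    qed
    moreover have "mset ws \<subseteq># mset xs"
      using ws(1) mset_take_subseteq subset_mset.trans by blast
    ultimately show ?thesis using True by (intro exI[of _ ws]) simp
  next
    case False
    then have "1 < m" using less.prems(1) by simp
    from trivial_action_prime[OF this less.prems(3)] obtain p m' where
      p: "prime p" "[s = 1] (mod p)" and m: "m = p * m'" and m': "0 < m'" "m' < m"
      and act: "[(s ^ p) ^ m' = 1] (mod m' * n)" by metis
    have "m' * n \<ge> 1" using m' less.prems(2) by simp
    then have "3 \<le> 2 * m' + 2 * (m' * n)" using m' by linarith
    then obtain r where r: "2 * m' + 2 * m' * n = r + 3" by (metis add.commute le_Suc_ex mult.assoc)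
    have "2 * m + 2 * m * n = p * (2 * m' + 2 * m' * n)" using m by (simp add: algebra_simps)
    then have "p * (r + 3) \<le> length xs + 3" using less.prems(4) r by simp
    then obtain Bs where Bs: "length Bs = r" "mset (concat Bs) \<subseteq># mset xs"
      "\<And>B. B \<in> set Bs \<Longrightarrow> length B = p \<and> kernel_block p s B"
      using blocks_exact[OF p] by metis
    obtain ys where ys: "mset ys \<subseteq># mset (map (contract p s) Bs)" "length ys = m' * n"
      "m' * n dvd xexp (s ^ p) ys" "m' dvd sum_list (map yexp ys)"
      using less.IH[OF m'(2,1) less.prems(2) act, of "map (contract p s) Bs"] Bs(1) r by auto
    then obtain Bs' where Bs': "set Bs' \<subseteq> set Bs" "map (contract p s) Bs' = ys"
      "mset (concat Bs') \<subseteq># mset xs"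
      "p * m' * n dvd xexp s (concat Bs')" "p * m' dvd sum_list (map yexp (concat Bs'))"
      using lift_blocks[of Bs xs p s ys m' n] Bs by metis
    have "length (concat Bs') = p * length Bs'"
      using Bs'(1) Bs(3) by (intro length_concat_const) auto
    then have "length (concat Bs') = p * (m' * n)" using ys(2) Bs'(2) by auto
    then show ?thesis using Bs' m by (intro exI[of _ "concat Bs'"]) (simp add: mult.assoc)
  qed
qed

section \<open>The semidirect product\<close>

lemma s_L_le:
  assumes "\<And>S. seq_over G S \<Longrightarrow> N \<le> size S \<Longrightarrow> \<exists>T. T \<subseteq># S \<and> product_one G T \<and> size T \<in> L"
  shows "s_L L G \<le> enat N"
  unfolding s_L_def by (rule Least_le) (use assms in auto)

lemma s_L_ge:
  assumes "seq_over G S" "N \<le> Suc (size S)"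
    and "\<And>T. T \<subseteq># S \<Longrightarrow> product_one G T \<Longrightarrow> size T \<notin> L"
  shows "enat N \<le> s_L L G"
proof (rule ccontr)
  let ?P = "\<lambda>l::enat. \<forall>S. seq_over G S \<and> l \<le> enat (size S) \<longrightarrow>
     (\<exists>T. T \<subseteq># S \<and> product_one G T \<and> size T \<in> L)"
  assume "\<not> enat N \<le> s_L L G"
  then have "s_L L G < enat N" by simp
  then obtain k where k: "s_L L G = enat k" "k < N" by (cases "s_L L G") auto
  \<comment> \<open>This provides the instance from which \<open>LeastI\<close> shows that the least
    value itself has the property.\<close>
  have "?P \<infinity>" by simp
  then have "?P (s_L L G)" unfolding s_L_def by (rule LeastI)
  then show False using assms k by fastforce
qed

text \<open>Turns inverses into natural powers, so that all exponents can stay in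
  \<open>nat\<close>.\<close>

lemma (in group) inv_pow_ord:
  assumes "g \<in> carrier G" "0 < ord g"
  shows "inv g = g [^] (ord g - 1)"
proof (rule inv_equality)
  have "g [^] (ord g - 1) \<otimes> g = g [^] Suc (ord g - 1)" by simp
  then show "g [^] (ord g - 1) \<otimes> g = \<one>" using assms by (simp add: pow_eq_id)
qed (use assms in auto)

locale cyclic_semidirect = group G for G :: "('a, 'b) monoid_scheme" (structure) +
  fixes m n s :: nat and x y :: 'a
  assumes pos: "0 < m" "0 < n"
    and x: "x \<in> carrier G" and y: "y \<in> carrier G"
    and generate: "generate G {x, y} = carrier G"
    and ord_x: "ord x = m * n" and ord_y: "ord y = m"
    and disjoint: "generate G {x} \<inter> generate G {y} = {\<one>}"
    and conj: "y \<otimes> x \<otimes> inv y = x [^] s"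
begin

section \<open>Normal forms \<open>x ^ i * y ^ j\<close> and the order of the action\<close>

lemma commute: "y \<otimes> x = x [^] s \<otimes> y"
  using conj x y by (metis inv_closed inv_equality m_assoc m_closed r_one l_inv)

lemma y_x_pow: "y \<otimes> x [^] i = x [^] (s * i) \<otimes> y" for i :: nat
proof (induction i)
  case (Suc i)
  have "y \<otimes> x [^] Suc i = (y \<otimes> x [^] i) \<otimes> x" using x y by (simp add: m_assoc)
  also have "\<dots> = x [^] (s * i) \<otimes> (y \<otimes> x)" unfolding Suc.IH using x y by (simp add: m_assoc)
  also have "\<dots> = x [^] (s * i) \<otimes> x [^] s \<otimes> y" unfolding commute using x y by (simp add: m_assoc)
  also have "\<dots> = x [^] (s * Suc i) \<otimes> y" using x by (simp add: nat_pow_mult add.commute)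
  finally show ?case .
qed (use x y in simp)

lemma y_pow_x_pow: "y [^] j \<otimes> x [^] i = x [^] (s ^ j * i) \<otimes> y [^] j" for i j :: nat
proof (induction j arbitrary: i)
  case (Suc j)
  have "y [^] Suc j \<otimes> x [^] i = y [^] j \<otimes> (y \<otimes> x [^] i)" using x y by (simp add: m_assoc)
  also have "\<dots> = (y [^] j \<otimes> x [^] (s * i)) \<otimes> y" unfolding y_x_pow using x y by (simp add: m_assoc)
  also have "\<dots> = x [^] (s ^ j * (s * i)) \<otimes> (y [^] j \<otimes> y)"
    unfolding Suc.IH using x y by (simp add: m_assoc)
  finally show ?case by (simp add: mult_ac)
qed (use x in simp)

lemma mult_normal_form:
  "(x [^] i \<otimes> y [^] j) \<otimes> (x [^] k \<otimes> y [^] l) = x [^] (i + s ^ j * k) \<otimes> y [^] (j + l)"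
  for i j k l :: nat
proof -
  have "(x [^] i \<otimes> y [^] j) \<otimes> (x [^] k \<otimes> y [^] l) = x [^] i \<otimes> (y [^] j \<otimes> x [^] k) \<otimes> y [^] l"
    using x y by (simp add: m_assoc)
  also have "\<dots> = (x [^] i \<otimes> x [^] (s ^ j * k)) \<otimes> (y [^] j \<otimes> y [^] l)"
    unfolding y_pow_x_pow using x y by (simp add: m_assoc)
  finally show ?thesis using x y by (simp add: nat_pow_mult)
qed

lemma normal_form:
  assumes "g \<in> carrier G"
  obtains i j :: nat where "g = x [^] i \<otimes> y [^] j"
proof -
  have "g \<in> generate G {x, y}" using assms generate by simp
  then have "\<exists>(i::nat) (j::nat). g = x [^] i \<otimes> y [^] j"
  proof induction
    case one
    show ?case by (intro exI[of _ "0::nat"]) simp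
  next
    case (incl h)
    have "x = x [^] (1::nat) \<otimes> y [^] (0::nat)" "y = x [^] (0::nat) \<otimes> y [^] (1::nat)"
      using x y by simp_all
    then show ?case using incl by blast
  next
    case (inv h)
    have "inv x = x [^] (ord x - 1) \<otimes> y [^] (0::nat)" "inv y = x [^] (0::nat) \<otimes> y [^] (ord y - 1)"
      using x y inv_pow_ord[of x] inv_pow_ord[of y] ord_x ord_y pos by simp_all
    then show ?case using inv by blast
  next
    case (eng g h)
    then show ?case using mult_normal_form by metis
  qed
  then show thesis using that by blast
qed

lemma pow_eq_one_iff: "x [^] i \<otimes> y [^] j = \<one> \<longleftrightarrow> m * n dvd i \<and> m dvd j" for i j :: nat
proof
  assume eq: "x [^] i \<otimes> y [^] j = \<one>"
  \<comment> \<open>This element lies in both cyclic subgroups, whose intersection is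
    trivial.\<close>
  then have "inv (x [^] i) = y [^] j" using x y by (metis inv_equality inv_comm nat_pow_closed)
  moreover have "inv (x [^] i) \<in> generate G {x}" "y [^] j \<in> generate G {y}"
    using x y generate_pow int_pow_int[of _ x i] int_pow_int[of _ y j] int_pow_neg[of x "int i"]
    by (auto simp: int_pow_int intro: exI[of _ "- int i"] exI[of _ "int j"])
  ultimately have "y [^] j = \<one>" using disjoint by auto
  then have "x [^] i = \<one>" using eq x by simp
  then show "m * n dvd i \<and> m dvd j"
    using \<open>y [^] j = \<one>\<close> x y ord_x ord_y by (simp add: pow_eq_id)
next
  assume "m * n dvd i \<and> m dvd j"
  then have "x [^] i = \<one>" "y [^] j = \<one>" using x y ord_x ord_y by (simp_all add: pow_eq_id)
  then show "x [^] i \<otimes> y [^] j = \<one>" by simp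
qed

text \<open>Conjugation by \<open>y ^ m = 1\<close> fixes \<open>x\<close> and also sends it to
  \<open>x ^ (s ^ m)\<close>; exponents of \<open>x\<close> count modulo
  \<open>m * n\<close>.\<close>

lemma action_power: "[s ^ m = 1] (mod m * n)"
proof -
  have "y [^] m = \<one>" using y ord_y by (simp add: pow_eq_id)
  then have "x = x [^] (s ^ m)" using y_pow_x_pow[of m 1] x by simp
  then have "x [^] (1::nat) = x [^] (s ^ m)" using x by simp
  then have "x [^] int 1 = x [^] int (s ^ m)" by (simp only: int_pow_int)
  then have "[int (s ^ m) = int 1] (mod int (m * n))"
    using x ord_x by (simp only: int_pow_eq cong_iff_dvd_diff)
  then show ?thesis by (simp only: cong_int_iff)
qed

definition elt :: "nat \<times> nat \<times> nat \<Rightarrow> 'a" where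
  "elt e = x [^] fst e \<otimes> y [^] yexp e"

lemma elt_closed: "elt e \<in> carrier G"
  using x y by (simp add: elt_def)

lemma foldr_elt:
  "foldr (\<otimes>) (map elt es) \<one> = x [^] xexp s es \<otimes> y [^] sum_list (map yexp es)"
proof (induction es)
  case (Cons e es)
  have "foldr (\<otimes>) (map elt (e # es)) \<one> = elt e \<otimes> foldr (\<otimes>) (map elt es) \<one>" by simp
  then show ?case unfolding Cons.IH elt_def[of e] mult_normal_form by simp
qed simp

lemma exponents_exist:
  assumes "seq_over G S"
  obtains es where "mset (map elt es) = S" "\<And>e. e \<in> set es \<Longrightarrow> weight e = 1"
proof -
  obtain gs where gs: "mset gs = S" using ex_mset by blast
  have "\<exists>e. g = elt e \<and> weight e = 1" if "g \<in> set gs" for g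
  proof -
    have "g \<in> carrier G" using that gs assms by (auto simp: seq_over_def)
    then obtain i j :: nat where "g = x [^] i \<otimes> y [^] j" by (rule normal_form)
    then show ?thesis by (intro exI[of _ "(i, j, 1)"]) (simp add: elt_def)
  qed
  then obtain f where f: "\<And>g. g \<in> set gs \<Longrightarrow> g = elt (f g) \<and> weight (f g) = 1" by metis
  then have "map elt (map f gs) = gs" by (simp add: map_idI)
  then show thesis using gs f by (intro that[of "map f gs"]) auto
qed

lemma product_one_elt:
  assumes "mset ys \<subseteq># mset es" "m * n dvd xexp s ys" "m dvd sum_list (map yexp ys)"
  shows "mset (map elt ys) \<subseteq># mset (map elt es)" "product_one G (mset (map elt ys))"
proof -
  show "mset (map elt ys) \<subseteq># mset (map elt es)"
    using image_mset_subseteq_mono[OF assms(1), of elt] by simp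
  show "product_one G (mset (map elt ys))"
    using foldr_elt[of ys] assms(2,3) pow_eq_one_iff unfolding product_one_def by metis
qed

section \<open>The bounds for the three invariants\<close>

lemma s_mult_le: "s_mult (m * n) G \<le> enat (m + 2 * m * n - 2)"
  unfolding s_mult_def
proof (rule s_L_le)
  fix S assume S: "seq_over G S" and len: "m + 2 * m * n - 2 \<le> size S"
  have "m * n \<ge> 1" using pos by simp
  then have ge: "m + 2 * m * n \<ge> 3" using pos by linarith
  obtain es where es: "mset (map elt es) = S" "\<And>e. e \<in> set es \<Longrightarrow> weight e = 1"
    using exponents_exist[OF S] by blast
  have "length es = size S" unfolding es(1)[symmetric] by simp
  then obtain e fs where es': "es = e # fs" using len ge by (cases es) auto
  \<comment> \<open>Together with \<open>e\<close>, which serves as the distinguished term, this has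
    exactly \<open>m + 2 * m * n - 2\<close> terms.\<close>
  let ?xs = "take (m + 2 * m * n - 3) fs"
  have sub: "mset (e # ?xs) \<subseteq># mset es"
    unfolding es' by (simp add: mset_take_subseteq)
  have "set ?xs \<subseteq> set es" unfolding es' using set_take_subset by fastforce
  then have "weight d = 1" if "d \<in> set ?xs" for d
    using that es(2) by blast
  moreover have "length ?xs + 3 = m + 2 * m * n" using \<open>length es = size S\<close> len ge es' by simp
  ultimately obtain ys where ys: "mset ys \<subseteq># mset (e # ?xs)" "ys \<noteq> []" "m * n dvd xexp s ys"
    "m dvd sum_list (map yexp ys)" "m * n dvd sum_list (map weight ys)"
    using semidirect_weighted[OF pos action_power, of ?xs e] by blast
  have ys_es: "mset ys \<subseteq># mset es" using ys(1) sub subset_mset.trans by blast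
  note T = product_one_elt[OF ys_es ys(3,4)]
  have "set ys \<subseteq> set es" using ys_es by (metis set_mset_mono set_mset_mset)
  then have "sum_list (map weight ys) = length ys"
    using es(2) by (intro sum_list_eq_length) blast
  then obtain k where k: "length ys = m * n * k" using ys(5) by auto
  then have "k \<ge> 1" using ys(2) by (cases k) auto
  then have "size (mset (map elt ys)) \<in> {k * (m * n) |k. 1 \<le> k}" using k by (auto simp: mult.commute)
  then show "\<exists>T. T \<subseteq># S \<and> product_one G T \<and> size T \<in> {k * (m * n) |k. 1 \<le> k}"
    using T unfolding es(1) by blast
qed

lemma s_mult_ge: "enat (m + 2 * m * n - 2) \<le> s_mult (m * n) G"
  unfolding s_mult_def
proof (rule s_L_ge)
  let ?es = "replicate (m * n - 1) (0, 0, 1) @ replicate (m * n - 1) (1, 0, 1) @ replicate (m - 1) (0, 1, 1)"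
  let ?S = "mset (map elt ?es)"
  have mn: "m * n \<ge> 1" using pos by simp
  show "seq_over G ?S" using elt_closed by (auto simp: seq_over_def)
  show "m + 2 * m * n - 2 \<le> Suc (size ?S)" using mn pos by simp
  fix T assume T: "T \<subseteq># ?S" "product_one G T"
  then obtain gs where gs: "mset gs = T" "foldr (\<otimes>) gs \<one> = \<one>" by (auto simp: product_one_def)
  then obtain ys where ys: "mset ys \<subseteq># mset ?es" "map elt ys = gs"
    using T(1) mset_subset_map[of gs elt ?es] by metis
  have "x [^] xexp s ys \<otimes> y [^] sum_list (map yexp ys) = \<one>"
    using gs(2) ys(2) foldr_elt[of ys] by simp
  then have dvd: "m * n dvd xexp s ys" "m dvd sum_list (map yexp ys)" using pow_eq_one_iff by auto
  have set: "set ys \<subseteq> {(0, 0, 1), (1, 0, 1), (0, 1, 1)}"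
    using set_mset_mono[OF ys(1)] by (auto split: if_splits)
  have count_yexp: "sum_list (map yexp ys) = count (mset ys) (0, 1, 1)"
    and count_xexp: "sum_list (map yexp ys) = 0 \<Longrightarrow> xexp s ys = count (mset ys) (1, 0, 1)"
    and count_length: "length ys = count (mset ys) (0, 0, 1) + count (mset ys) (1, 0, 1) + count (mset ys) (0, 1, 1)"
    using set by (induction ys) auto
  have le: "count (mset ys) e \<le> count (mset ?es) e" for e
    using ys(1) by (rule mset_subset_eq_count)
  \<comment> \<open>Fewer than \<open>m\<close> copies of \<open>y\<close> are available, so none
    can be used; then the exponent at \<open>x\<close> is just the number of copies of
    \<open>x\<close>, again too small, and fewer than \<open>m * n\<close> identities are
    left.\<close>
  have "sum_list (map yexp ys) < m" using le[of "(0, 1, 1)"] count_yexp pos by simp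
  then have 0: "sum_list (map yexp ys) = 0" using dvd(2) by (meson nat_dvd_not_less not_gr_zero)
  have "count (mset ys) (1, 0, 1) \<le> m * n - 1" using le[of "(1, 0, 1)"] by simp
  then have "xexp s ys < m * n" unfolding count_xexp[OF 0] using mn by linarith
  then have "xexp s ys = 0" using dvd(1) by (meson nat_dvd_not_less not_gr_zero)
  then have "length ys = count (mset ys) (0, 0, 1)" using 0 count_yexp count_xexp count_length by simp
  moreover have "count (mset ys) (0, 0, 1) \<le> m * n - 1" using le[of "(0, 0, 1)"] by simp
  ultimately have "length ys < m * n" using mn by linarith
  moreover have "size T = length ys" using gs(1) ys(2) by auto
  ultimately show "size T \<notin> {k * (m * n) |k. 1 \<le> k}" by auto
qed

lemma eta_inv_le:
  assumes "max_ord G = m * n"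
  shows "eta_inv G \<le> enat (2 * m + m * n - 2)"
  unfolding eta_inv_def assms
proof (rule s_L_le)
  fix S assume S: "seq_over G S" and len: "2 * m + m * n - 2 \<le> size S"
  obtain es where es: "mset (map elt es) = S" using exponents_exist[OF S] by blast
  then have "2 * m + m * n \<le> length es + 2" using len by auto
  then obtain ys where ys: "mset ys \<subseteq># mset es" "ys \<noteq> []" "length ys \<le> m * n"
    "m * n dvd xexp s ys" "m dvd sum_list (map yexp ys)"
    using semidirect_short[OF pos action_power] by blast
  have "size (mset (map elt ys)) \<in> {1..m * n}" using ys(2,3) by (cases ys) auto
  then show "\<exists>T. T \<subseteq># S \<and> product_one G T \<and> size T \<in> {1..m * n}"
    using product_one_elt[OF ys(1,4,5)] unfolding es by blast
qed

lemma s_inv_le: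
  assumes "max_ord G = m * n"
  shows "s_inv G \<le> enat (2 * m + 2 * m * n - 3)"
  unfolding s_inv_def assms
proof (rule s_L_le)
  fix S assume S: "seq_over G S" and len: "2 * m + 2 * m * n - 3 \<le> size S"
  obtain es where es: "mset (map elt es) = S" using exponents_exist[OF S] by blast
  then have "2 * m + 2 * m * n \<le> length es + 3" using len by auto
  then obtain ys where ys: "mset ys \<subseteq># mset es" "length ys = m * n"
    "m * n dvd xexp s ys" "m dvd sum_list (map yexp ys)"
    using semidirect_exact[OF pos action_power] by blast
  have "size (mset (map elt ys)) \<in> {m * n}" using ys(2) by simp
  then show "\<exists>T. T \<subseteq># S \<and> product_one G T \<and> size T \<in> {m * n}"
    using product_one_elt[OF ys(1,3,4)] unfolding es by blast
qed

end

theorem theorem1p3: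
  fixes G :: "('a, 'b) monoid_scheme" and m n :: nat
  assumes "0 < m" and "0 < n"
    and "is_cyclic_semidirect m (m * n) G"
  shows "s_mult (m * n) G = enat (m + 2 * m * n - 2) \<and>
    (max_ord G = m * n \<longrightarrow>
       eta_inv G \<le> enat (2 * m + m * n - 2) \<and>
       s_inv G \<le> enat (2 * m + 2 * m * n - 3))"
proof -
  obtain x y s where "group G" "x \<in> carrier G" "y \<in> carrier G" "generate G {x, y} = carrier G"
    "group.ord G x = m * n" "group.ord G y = m" "generate G {x} \<inter> generate G {y} = {\<one>\<^bsub>G\<^esub>}"
    "y \<otimes>\<^bsub>G\<^esub> x \<otimes>\<^bsub>G\<^esub> inv\<^bsub>G\<^esub> y = x [^]\<^bsub>G\<^esub> (s::nat)"
    using assms(3) unfolding is_cyclic_semidirect_def by blast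
  then interpret cyclic_semidirect G m n s x y
    using assms(1,2) by (intro cyclic_semidirect.intro cyclic_semidirect_axioms.intro)
  show ?thesis
    using s_mult_le s_mult_ge eta_inv_le s_inv_le by (auto intro: antisym)
qed

end
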